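(* Let $G = T(r,s,t)$ for integers $r \geq 1$, $s \geq 1$, $0 \leq t \leq s-1$ be a $6$-regular triangulation on the torus. If $r = 1$, then $T(1,s,t)$ is isomorphic to $T(1,s,s-t-1)$, so in this case consider $t$ only in the range $0 \leq t \leq \lfloor (s-1)/2 \rfloor$ (this restriction applies to every graph $T(1,s,t)$ mentioned below). Then: (a) $G$ contains loops if and only if either $s = 1$, or $r = 1$ and $s = 2$, or $r = 1$ and $t = 0$. (b) $G$ is $7$-chromatic if and only if $G$ is isomorphic to $K_7$, and this happens only when $G = T(1,7,2)$ (that is, $G$ is $7$-chromatic if and only if $(r,s,t) = (1,7,2)$). (c) $G$ is $6$-chromatic if and only if $G$ is isomorphic either to $K_6$ (after deleting duplicated edges) or to the Albertson--Hutchinson graph on $11$ vertices. The former happens exactly when $G \in \{T(1,6,2), T(2,3,0), T(2,3,1), T(3,2,0), T(3,2,1)\}$, and the latter exactly when $G \in \{T(1,11,2), T(1,11,3), T(1,11,4)\}$. (d) $G$ is $5$-chromatic if and only if $G$ is one of the following graphs: - $T(1,5,1)$, $T(1,5,2)$ (these are isomorphic to $K_5$ after deleting duplicated edges); - $T(1,s,2)$ for $s \geq 9$, $s \neq 11$, $s \not\equiv 0 \pmod 4$; - $T(1,s,t)$ for $s \in \{2t+2, 2t+3, 3t+1, 3t+2\}$, $s \geq 9$, $s \neq 11$, $s \not\equiv 0 \pmod 4$; - $T(2,s,0)$, $T(2,s,1)$, $T(2,s,s-3)$, $T(2,s,s-2)$ for odd $s \geq 5$; - $T(3,s,s-2)$,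 $T(3,s,s-1)$ for $s \geq 3$, $s \not\equiv 0 \pmod 4$; - $T(r,2,0)$, $T(r,2,1)$ for odd $r \geq 5$; - $T(1,s,t)$ for $(t,s) \in \{(3,13), (3,17), (3,18), (3,25), (4,17), (6,17), (6,25), (6,33), (7,19), (7,25), (7,26), (9,25), (10,25), (10,26), (10,37), (14,33)\}$; - $T(2,s,t)$ for $(t,s) \in \{(3,9), (3,13), (4,9), (8,13)\}$; - $T(3,s,t)$ for $(t,s) \in \{(1,6), (2,6), (2,11), (6,11)\}$; - $T(5,s,t)$ for $(t,s) \in \{(2,5), (3,5)\}$. (e) $G$ is $4$-colorable in all other cases (i.e. whenever $G$ has no loops and is not one of the graphs in (b), (c), (d)). (f) In particular, $G$ is $3$-chromatic if and only if $s \equiv 0 \pmod 3$ and $r - t \equiv 0 \pmod 3$.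
   Context: Definition of $T(r,s,t)$: for integers $r \geq 1$, $s \geq 1$, $0 \leq t \leq s-1$, the graph $T(r,s,t)$ (possibly with loops or multiple edges) has vertex set $\{(i,j) : 1 \leq i \leq r,\ 1 \leq j \leq s\}$, where first coordinates are read modulo $r$ and second coordinates modulo $s$, with the following adjacencies (each vertex has six listed neighbours): - for $1 < i < r$, $(i,j)$ is adjacent to $(i, j \pm 1)$, $(i \pm 1, j)$ and $(i \pm 1, j \mp 1)$; - if $r > 1$, $(1,j)$ is adjacent to $(1, j \pm 1)$, $(2,j)$, $(2,j-1)$, $(r, j+t+1)$ and $(r, j+t)$; - if $r > 1$, $(r,j)$ is adjacent to $(r, j \pm 1)$, $(r-1, j+1)$, $(r-1,j)$, $(1, j-t)$ and $(1, j-t-1)$; - if $r = 1$, $(1,j)$ is adjacent to $(1, j \pm 1)$, $(1, j \pm t)$ and $(1, j \pm (t+1))$. Every $T(r,s,t)$ is regarded as a $6$-regular triangulation on the torus. A loop is present when some vertex is listed as its own neighbour. Colorings are proper vertex colorings; a graph with a loop has no proper coloring and so has no chromatic number; multiple edges do not affect colorability. "$k$-chromatic" means having chromatic number exactly $k$; "$4$-colorable" means having a proper coloring with at most $4$ colors. $K_m$ is the complete graph on $m$ vertices. The Albertson--Hutchinson graph on $11$ vertices is the unique (up to isomorphism) simple $6$-regular triangulation on the torus with $11$ vertices; it is isomorphic to $T(1,11,2)$. *)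

theory Defs
  imports Graph_Theory.Graph_Theory
begin

text \<open>
  As in the Graph_Theory library, an undirected multigraph is a symmetric digraph: an edge
  joining two vertices is a pair of opposite arcs, and parallel edges are parallel arcs.
  Each of the six listed neighbours of a vertex contributes one arc leaving that vertex, so that
  a loop shows up as two arcs from the vertex to itself.
\<close>

definition wrap :: "int \<Rightarrow> int \<Rightarrow> int" where
  "wrap n x = (x - 1) mod n + 1"

text \<open>
  The neighbours of \<open>(i, j)\<close> before the coordinates are reduced to the representatives
  \<open>1, \<dots>, r\<close> and \<open>1, \<dots>, s\<close>; the order within a list is immaterial.
\<close>

definition T_listed :: "int \<Rightarrow> int \<Rightarrow> int \<times> int \<Rightarrow> (int \<times> int) list" where
  "T_listed r t = (\<lambda>(i, j).
     if r = 1 then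
       [(1, j + 1), (1, j - 1), (1, j + t), (1, j - t), (1, j + (t + 1)), (1, j - (t + 1))]
     else if i = 1 then
       [(1, j + 1), (1, j - 1), (2, j), (2, j - 1), (r, j + t + 1), (r, j + t)]
     else if i = r then
       [(r, j + 1), (r, j - 1), (r - 1, j + 1), (r - 1, j), (1, j - t), (1, j - t - 1)]
     else
       [(i, j + 1), (i, j - 1), (i + 1, j), (i - 1, j), (i + 1, j - 1), (i - 1, j + 1)])"

definition T_nbrs :: "int \<Rightarrow> int \<Rightarrow> int \<Rightarrow> int \<times> int \<Rightarrow> (int \<times> int) list" where
  "T_nbrs r s t v = map (map_prod (wrap r) (wrap s)) (T_listed r t v)"

text \<open>The arc \<open>(v, k)\<close> runs from \<open>v\<close> to the \<open>k\<close>-th listed neighbour of \<open>v\<close>.\<close>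

definition T :: "int \<Rightarrow> int \<Rightarrow> int \<Rightarrow> (int \<times> int, (int \<times> int) \<times> nat) pre_digraph" where
  "T r s t = \<lparr> verts = {1..r} \<times> {1..s},
               arcs = ({1..r} \<times> {1..s}) \<times> {..<6},
               tail = fst,
               head = (\<lambda>(v, k). T_nbrs r s t v ! k) \<rparr>"

text \<open>
  Adjacency in \<open>T r s t\<close> is symmetric, and every vertex has degree 6 counting multiplicities.
\<close>

lemma wrap_in: "n \<ge> 1 \<Longrightarrow> wrap n x \<in> {1..n}"
  by (auto simp: wrap_def) (smt (verit) pos_mod_bound)

lemma wrap_id: "x \<in> {1..n} \<Longrightarrow> wrap n x = x"
  by (auto simp: wrap_def)

lemma wrap_shift: "wrap n (wrap n x + a) = wrap n (x + a)" "wrap n (wrap n x - a) = wrap n (x - a)"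
proof -
  have e: "wrap n (wrap n x + b) = wrap n (x + b)" for b
  proof -
    have "wrap n (wrap n x + b) = ((x - 1) mod n + b) mod n + 1" unfolding wrap_def by simp
    also have "\<dots> = (x - 1 + b) mod n + 1" by (simp add: mod_add_left_eq)
    finally show ?thesis by (simp add: wrap_def algebra_simps)
  qed
  show "wrap n (wrap n x + a) = wrap n (x + a)" by (rule e)
  show "wrap n (wrap n x - a) = wrap n (x - a)" using e[of "- a"] by simp
qed

lemma length_T_nbrs: "length (T_nbrs r s t v) = 6"
  by (auto simp: T_nbrs_def T_listed_def split: prod.split)

lemma T_nbrs_in_verts:
  assumes "r \<ge> 1" "s \<ge> 1" "u \<in> set (T_nbrs r s t v)"
  shows "u \<in> {1..r} \<times> {1..s}"
  using assms(3) wrap_in[OF assms(1)] wrap_in[OF assms(2)] by (auto simp: T_nbrs_def)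

lemma wrap_shift': "wrap n (a + wrap n x) = wrap n (a + x)"
    "wrap n (a + (b + wrap n x)) = wrap n (a + (b + x))"
  using wrap_shift(1)[of n x a] wrap_shift(1)[of n x "a + b"] by (simp_all add: ac_simps)

lemma T_nbrs_simps:
  "T_nbrs 1 s t (i, j) =
     [(1, wrap s (j + 1)), (1, wrap s (j - 1)), (1, wrap s (j + t)), (1, wrap s (j - t)),
      (1, wrap s (j + (t + 1))), (1, wrap s (j - (t + 1)))]"
  "r > 1 \<Longrightarrow> T_nbrs r s t (1, j) =
     [(1, wrap s (j + 1)), (1, wrap s (j - 1)), (2, wrap s j), (2, wrap s (j - 1)),
      (r, wrap s (j + t + 1)), (r, wrap s (j + t))]"
  "r > 1 \<Longrightarrow> T_nbrs r s t (r, j) =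
     [(r, wrap s (j + 1)), (r, wrap s (j - 1)), (r - 1, wrap s (j + 1)), (r - 1, wrap s j),
      (1, wrap s (j - t)), (1, wrap s (j - t - 1))]"
  "1 < i \<Longrightarrow> i < r \<Longrightarrow> T_nbrs r s t (i, j) =
     [(i, wrap s (j + 1)), (i, wrap s (j - 1)), (i + 1, wrap s j), (i - 1, wrap s j),
      (i + 1, wrap s (j - 1)), (i - 1, wrap s (j + 1))]"
  by (simp_all add: T_nbrs_def T_listed_def wrap_id)

lemma T_nbrs_sym:
  assumes v: "v \<in> {1..r} \<times> {1..s}" and u: "u \<in> set (T_nbrs r s t v)"
  shows "v \<in> set (T_nbrs r s t u)"
proof -
  obtain i j where ij: "v = (i, j)" "1 \<le> i" "i \<le> r" "1 \<le> j" "j \<le> s" using v by auto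
  have wj: "wrap s j = j" using ij by (simp add: wrap_id)
  have wb: "wrap s (wrap s (j + a) - a) = j" "wrap s (wrap s (j - a) + a) = j" for a
    using wj by (simp_all add: wrap_shift)
  have wb': "wrap s (wrap s (j + a + 1) - a - 1) = j" "wrap s (wrap s (j - a - 1) + a + 1) = j"
    "wrap s (wrap s (j - a) + a) = j" "wrap s (wrap s (j - 1) + 1) = j" for a
    using wb(1)[of "a + 1"] wb(2)[of "a + 1"] wb(2) by (simp_all add: algebra_simps)
  consider "r = 1" "i = 1" | "r > 1" "i = 1" | "r > 1" "i = r" | "1 < i" "i < r"
    using ij by linarith
  then show ?thesis
  proof cases
    case 1
    then show ?thesis using u unfolding ij(1) by (auto simp: T_nbrs_simps wb wb' wj)
  next
    case 2
    moreover from 2 have "2 = r \<or> 1 < (2::int) \<and> 2 < r" by auto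
    ultimately show ?thesis using u unfolding ij(1) by (auto simp: T_nbrs_simps wb wb' wj)
  next
    case 3
    moreover from 3 have "r - 1 = 1 \<or> 1 < r - 1 \<and> r - 1 < r" by auto
    ultimately show ?thesis using u unfolding ij(1) by (auto simp: T_nbrs_simps wb wb' wj)
  next
    case 4
    moreover from 4 have "i + 1 = r \<or> 1 < i + 1 \<and> i + 1 < r" "i - 1 = 1 \<or> 1 < i - 1 \<and> i - 1 < r"
      by auto
    ultimately show ?thesis using u unfolding ij(1) by (auto simp: T_nbrs_simps wb wb' wj)
  qed
qed

lemma T_arcs_ends:
  "arcs_ends (T r s t) = {(v, u). v \<in> {1..r} \<times> {1..s} \<and> u \<in> set (T_nbrs r s t v)}"
proof (intro set_eqI iffI)
  fix p assume "p \<in> arcs_ends (T r s t)"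
  then show "p \<in> {(v, u). v \<in> {1..r} \<times> {1..s} \<and> u \<in> set (T_nbrs r s t v)}"
    by (auto simp: T_def arcs_ends_conv length_T_nbrs)
next
  fix p assume "p \<in> {(v, u). v \<in> {1..r} \<times> {1..s} \<and> u \<in> set (T_nbrs r s t v)}"
  then obtain v k where "v \<in> {1..r} \<times> {1..s}" "k < 6" "p = (v, T_nbrs r s t v ! k)"
    by (auto simp: in_set_conv_nth length_T_nbrs)
  then show "p \<in> arcs_ends (T r s t)"
    unfolding arcs_ends_conv by (intro image_eqI[where x = "(v, k)"]) (auto simp: T_def)
qed

lemma T_pseudo_graph:
  assumes "r \<ge> 1" "s \<ge> 1"
  shows "pseudo_graph (T r s t)"
proof
  fix e assume e: "e \<in> arcs (T r s t)"
  then show "tail (T r s t) e \<in> verts (T r s t)" by (auto simp: T_def)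
  from e show "head (T r s t) e \<in> verts (T r s t)"
    using T_nbrs_in_verts[OF assms nth_mem] by (auto simp: T_def length_T_nbrs split: prod.splits)
next
  show "symmetric (T r s t)"
    unfolding symmetric_def T_arcs_ends sym_def
    using T_nbrs_sym T_nbrs_in_verts[OF assms] by fast
qed (auto simp: T_def)

lemma T_out_degree:
  assumes "v \<in> verts (T r s t)"
  shows "out_degree (T r s t) v = 6"
proof -
  have "out_arcs (T r s t) v = {v} \<times> {..<6}" using assms by (auto simp: T_def out_arcs_def)
  then show ?thesis by (simp add: out_degree_def card_cartesian_product)
qed

definition has_loop :: "('a, 'b) pre_digraph \<Rightarrow> bool" where
  "has_loop G \<longleftrightarrow> (\<exists>e \<in> arcs G. tail G e = head G e)"

definition colorable :: "nat \<Rightarrow> ('a, 'b) pre_digraph \<Rightarrow> bool" where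
  "colorable k G \<longleftrightarrow> (\<exists>c :: 'a \<Rightarrow> nat. (\<forall>v \<in> verts G. c v < k) \<and>
                           (\<forall>e \<in> arcs G. c (tail G e) \<noteq> c (head G e)))"

text \<open>Having chromatic number exactly \<open>k\<close>; false for every \<open>k\<close> if \<open>G\<close> has a loop.\<close>

definition chromatic :: "nat \<Rightarrow> ('a, 'b) pre_digraph \<Rightarrow> bool" where
  "chromatic k G \<longleftrightarrow> colorable k G \<and> (\<forall>l < k. \<not> colorable l G)"

text \<open>
  Deletion of duplicated edges: the arcs of \<open>mk_symmetric G\<close> are the pairs of adjacent vertices,
  loops included.
\<close>

definition dedup :: "('a, 'b) pre_digraph \<Rightarrow> ('a, 'a \<times> 'a) pre_digraph" where
  "dedup G = with_proj (mk_symmetric G)"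

text \<open>
  The unique simple 6-regular triangulation of the torus with 11 vertices, in its presentation
  as a graph \<open>T r s t\<close>. Only its isomorphism class is used.
\<close>

definition Albertson_Hutchinson ::
    "(int \<times> int, (int \<times> int) \<times> nat) pre_digraph" where
  "Albertson_Hutchinson = T 1 11 2"

lemma Albertson_Hutchinson_graph: "graph Albertson_Hutchinson" "card (verts Albertson_Hutchinson) = 11"
proof -
  interpret pseudo_graph "T 1 11 2" by (rule T_pseudo_graph) auto
  have d: "distinct ((1, j) # T_nbrs 1 11 2 (1, j))" if "1 \<le> j" "j \<le> 11" for j
  proof -
    have "j \<in> {1,2,3,4,5,6,7,8,9,10,11}" using that by (simp; presburger)
    then show ?thesis by (auto simp: T_nbrs_def T_listed_def wrap_def)
  qed
  show "graph Albertson_Hutchinson" unfolding Albertson_Hutchinson_def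
  proof
    fix e assume "e \<in> arcs (T 1 11 2)"
    then obtain j k where e: "e = ((1, j), k)" "1 \<le> j" "j \<le> 11" "k < 6" by (auto simp: T_def)
    have "T_nbrs 1 11 2 (1, j) ! k \<in> set (T_nbrs 1 11 2 (1, j))" using e by (simp add: length_T_nbrs)
    then show "tail (T 1 11 2) e \<noteq> head (T 1 11 2) e" using d[of j] e by (auto simp: T_def)
  next
    fix e1 e2 assume "e1 \<in> arcs (T 1 11 2)" "e2 \<in> arcs (T 1 11 2)"
      and q: "arc_to_ends (T 1 11 2) e1 = arc_to_ends (T 1 11 2) e2"
    then obtain j k j' k' where e: "e1 = ((1, j), k)" "1 \<le> j" "j \<le> 11" "k < 6"
      "e2 = ((1, j'), k')" "k' < 6" by (auto simp: T_def)
    then show "e1 = e2" using d[of j] q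
      by (auto simp: T_def arc_to_ends_def nth_eq_iff_index_eq length_T_nbrs)
  qed
  show "card (verts Albertson_Hutchinson) = 11"
    by (simp add: Albertson_Hutchinson_def T_def card_cartesian_product)
qed

definition K6_params :: "(int \<times> int \<times> int) set" where
  "K6_params = {(1,6,2), (2,3,0), (2,3,1), (3,2,0), (3,2,1)}"

definition AH_params :: "(int \<times> int \<times> int) set" where
  "AH_params = {(1,11,2), (1,11,3), (1,11,4)}"

text \<open>
  The triples with \<open>r = 1\<close> all satisfy \<open>t \<le> (s - 1) div 2\<close>. In the last four sets of
  sporadic graphs the pairs are \<open>(t, s)\<close>, not \<open>(s, t)\<close>.
\<close>

definition five_chromatic_params :: "(int \<times> int \<times> int) set" where
  "five_chromatic_params =
     {(1,5,1), (1,5,2)}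
   \<union> {(1, s, 2) | s. s \<ge> 9 \<and> s \<noteq> 11 \<and> \<not> 4 dvd s}
   \<union> {(1, s, t) | s t. s \<in> {2*t + 2, 2*t + 3, 3*t + 1, 3*t + 2} \<and> s \<ge> 9 \<and> s \<noteq> 11 \<and> \<not> 4 dvd s}
   \<union> {(2, s, t) | s t. t \<in> {0, 1, s - 3, s - 2} \<and> odd s \<and> s \<ge> 5}
   \<union> {(3, s, t) | s t. t \<in> {s - 2, s - 1} \<and> s \<ge> 3 \<and> \<not> 4 dvd s}
   \<union> {(r, 2, t) | r t. t \<in> {0, 1} \<and> odd r \<and> r \<ge> 5}
   \<union> {(1, s, t) | s t. (t, s) \<in> {(3,13), (3,17), (3,18), (3,25), (4,17), (6,17), (6,25), (6,33),
        (7,19), (7,25), (7,26), (9,25), (10,25), (10,26), (10,37), (14,33)}}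
   \<union> {(2, s, t) | s t. (t, s) \<in> {(3,9), (3,13), (4,9), (8,13)}}
   \<union> {(3, s, t) | s t. (t, s) \<in> {(1,6), (2,6), (2,11), (6,11)}}
   \<union> {(5, s, t) | s t. (t, s) \<in> {(2,5), (3,5)}}"

end

theory Submission
  imports Defs
begin

text \<open>
  \<open>T r s t\<close> is the triangular lattice on \<open>\<int> \<times> \<int>\<close>, with steps \<open>(1, 0)\<close>, \<open>(0, 1)\<close>, \<open>(1, -1)\<close> and their
  negatives, modulo the sublattice \<open>L\<close> spanned by \<open>(r, t)\<close> and \<open>(0, s)\<close>. A homomorphism \<open>F\<close> from the
  lattice to the circle that kills \<open>L\<close> and moves every step by at least \<open>1/q\<close> yields a
  \<open>q\<close>-colouring: cut the circle into \<open>q\<close> half-open arcs. Such \<open>F\<close> are the points of the dual lattice of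
  \<open>L\<close> in a fixed triangle of the torus. If \<open>u\<close> is a shortest vector of \<open>L\<close>, the dual lattice lies on the
  lines \<open>F u = k\<close>, and for \<open>q = 4\<close> one of them meets the triangle in a segment long
  enough to contain a dual point as soon as the index \<open>r s\<close> is at least 56, unless \<open>u\<close> has norm 1
  (a loop), 4 or 7. These last two norms give exactly the infinite
  families: norm 7 makes the quotient the cube of a cycle, which is 4-colourable only when its
  length is divisible by 4, and norm 4 makes it a cyclic sequence of edges, consecutive ones spanning a
  \<open>K\<^sub>4\<close>, which forces the length to be even. The quotients of index at most 55 are finitely many;
  the sporadic exceptions among them are circulant graphs on \<open>n\<close> vertices with
  independence number less than \<open>n / 4\<close>.
\<close>

section \<open>Lattice colourings\<close>

text \<open>Write F as (alpha, - beta). The triangle is alpha >= 1/q, beta >= 1/q, alpha + beta <= 1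
  - 1/q, and for u = (a, b) the number q F(u) equals a - b, a - (q - 2) b and (q - 2) a - b at its
  corners. For q = 4 this singles out three norms: with u = (1, 0) no line F(u) = k meets the
  triangle, and with u = (2, 0) or (2, 1) exactly one does, in a single corner. For every other u in
  the sector 0 <= b <= a some line shares a genuine segment with the triangle, on which the dual
  points are equally spaced, with a gap inversely proportional to the index. Characters do not give
  every colouring: the 4-colourable \<open>T 2 2 0\<close> has none of the kind required, so parity
  colourings are added for norm 4, and some quotients of small index get explicit colourings. For
  five colours the only 5-chromatic graph without a character is \<open>T 1 13 3\<close>.\<close>

definition lattice_coloring :: "nat \<Rightarrow> int \<Rightarrow> int \<Rightarrow> int \<Rightarrow> (int \<Rightarrow> int \<Rightarrow> nat) \<Rightarrow> bool" where
  "lattice_coloring k r s t c \<longleftrightarrow>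
     (\<forall>x y. c x y < k \<and> c x (y + s) = c x y \<and> c (x + r) (y + t) = c x y \<and>
            c (x + 1) y \<noteq> c x y \<and> c x (y + 1) \<noteq> c x y \<and> c (x + 1) y \<noteq> c x (y + 1))"

lemma lattice_coloringD:
  assumes "lattice_coloring k r s t c"
  shows "c x y < k" "c x (y + s) = c x y" "c (x + r) (y + t) = c x y"
    "c (x + 1) y \<noteq> c x y" "c x (y + 1) \<noteq> c x y" "c (x + 1) y \<noteq> c x (y + 1)"
  using assms unfolding lattice_coloring_def by blast+

lemma int_translation_invariant:
  fixes f :: "int \<Rightarrow> 'a"
  assumes "\<And>x. f (x + p) = f x"
  shows "f (x + p * k) = f x"
proof (induction k arbitrary: x rule: int_induct[where k = 0])
  case (step1 i)
  have "f (x + p * (i + 1)) = f ((x + p * i) + p)" by (simp add: algebra_simps)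
  then show ?case using step1 assms by simp
next
  case (step2 i)
  have "f (x + p * (i - 1)) = f ((x + p * (i - 1)) + p)" by (simp only: assms)
  also have "\<dots> = f (x + p * i)" by (simp add: algebra_simps)
  finally show ?case using step2 by simp
qed simp

lemma lattice_coloring_periodic:
  assumes "lattice_coloring k r s t c"
  shows "c (x + r * i) (y + t * i + s * j) = c x y"
proof -
  have "c (x + r * i) (y + t * i + s * j) = c (x + r * i) (y + t * i)"
    using lattice_coloringD(2)[OF assms] int_translation_invariant[of "c (x + r * i)" s] by blast
  also have "\<dots> = c x y"
  proof -
    have "c (x + r * (a + 1)) (y + t * (a + 1)) = c (x + r * a) (y + t * a)" for a
      using lattice_coloringD(3)[OF assms, of "x + r * a" "y + t * a"] by (simp add: algebra_simps)
    then show ?thesis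
      using int_translation_invariant[of "\<lambda>a. c (x + r * a) (y + t * a)" 1 0 i] by simp
  qed
  finally show ?thesis .
qed

lemma wrap_decomp: "x = wrap n x + n * ((x - 1) div n)"
  by (simp add: wrap_def)

lemma colorable_T_iff:
  "colorable k (T r s t) \<longleftrightarrow>
     (\<exists>f. (\<forall>v \<in> {1..r} \<times> {1..s}. f v < k) \<and>
          (\<forall>v \<in> {1..r} \<times> {1..s}. \<forall>u \<in> set (T_nbrs r s t v). f v \<noteq> f u))"
proof -
  have *: "(\<forall>e \<in> arcs G. f (tail G e) \<noteq> f (head G e)) \<longleftrightarrow> (\<forall>p \<in> arcs_ends G. f (fst p) \<noteq> f (snd p))"
    for f :: "int \<times> int \<Rightarrow> nat" and G :: "(int \<times> int, (int \<times> int) \<times> nat) pre_digraph"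
    by (auto simp: arcs_ends_def arc_to_ends_def)
  show ?thesis unfolding colorable_def * T_arcs_ends by (intro ex_cong1) (force simp: T_def)
qed

lemma colorable_of_lattice_coloring:
  assumes rs: "r \<ge> 1" "s \<ge> 1" and c: "lattice_coloring k r s t c"
  shows "colorable k (T r s t)"
  unfolding colorable_T_iff
proof (intro exI[of _ "\<lambda>(x, y). c x y"] conjI ballI)
  note C = lattice_coloringD[OF c]
  have w: "c x (wrap s y) = c x y" for x y
    using lattice_coloring_periodic[OF c, of x 0 "wrap s y" "(y - 1) div s"] wrap_decomp[of y s] by simp
  \<comment> \<open>Trading a shift by \<open>t\<close> for a shift by \<open>r\<close> in the first
    coordinate turns the wrap-around neighbours of rows 1 and \<open>r\<close> into ordinary lattice
    steps.\<close>
  have sh: "c x (y + t) = c (x - r) y" for x y using C(3)[of "x - r" y] by simp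
  have sh': "c x (y - t) = c (x + r) y" for x y using C(3)[of x "y - t"] by simp
  fix v u assume v: "v \<in> {1..r} \<times> {1..s}" and u: "u \<in> set (T_nbrs r s t v)"
  obtain i j where ij: "v = (i, j)" "1 \<le> i" "i \<le> r" by (cases v) (use v in auto)
  have e: "c x y \<noteq> c (x + 1) y" "c x y \<noteq> c (x - 1) y" "c x y \<noteq> c x (y + 1)" "c x y \<noteq> c x (y - 1)"
    "c x y \<noteq> c (x + 1) (y - 1)" "c x y \<noteq> c (x - 1) (y + 1)" for x y
    using C(4)[of x y] C(4)[of "x - 1" y] C(5)[of x y] C(5)[of x "y - 1"] C(6)[of x "y - 1"]
      C(6)[of "x - 1" y] by (simp_all add: eq_commute)
  have e1: "c i j \<noteq> c 1 (j + 1 + t)" "c i j \<noteq> c 1 (j - 1 - t)" "c i j \<noteq> c 1 (j + t)" "c i j \<noteq> c 1 (j - t)"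
    if "r = 1" using e[of 1 j] that ij by (simp_all only: sh sh') auto
  have e2: "c 1 j \<noteq> c r (j + 1 + t)" "c 1 j \<noteq> c r (j + t)"
    using e[of 1 j] by (simp_all add: sh sh')
  have e3: "c r j \<noteq> c 1 (j - t)" "c r j \<noteq> c 1 (j - 1 - t)"
    using e[of r j] by (simp_all only: sh') (simp_all add: ac_simps)
  consider "r = 1" "i = 1" | "r > 1" "i = 1" | "r > 1" "i = r" | "1 < i" "i < r"
    using ij by linarith
  then have "c i j \<noteq> (case u of (x, y) \<Rightarrow> c x y)"
  proof cases
    case 1
    then show ?thesis using u e[of 1 j] e1 unfolding ij(1)
      by (auto simp: T_nbrs_simps w algebra_simps)
  next
    case 2
    then show ?thesis using u e[of 1 j] e2 unfolding ij(1)
      by (auto simp: T_nbrs_simps w algebra_simps)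
  next
    case 3
    then show ?thesis using u e[of r j] e3 unfolding ij(1)
      by (auto simp: T_nbrs_simps w algebra_simps)
  next
    case 4
    then show ?thesis using u e[of i j] unfolding ij(1)
      by (auto simp: T_nbrs_simps w algebra_simps)
  qed
  then show "(case v of (x, y) \<Rightarrow> c x y) \<noteq> (case u of (x, y) \<Rightarrow> c x y)" by (simp add: ij(1))
qed (use lattice_coloringD(1)[OF c] in auto)

lemma lattice_coloring_of_colorable:
  assumes rs: "r \<ge> 1" "s \<ge> 1" and "colorable k (T r s t)"
  obtains c where "lattice_coloring k r s t c"
proof -
  obtain f where f: "\<And>v. v \<in> {1..r} \<times> {1..s} \<Longrightarrow> f v < k"
    and ne: "\<And>v u. v \<in> {1..r} \<times> {1..s} \<Longrightarrow> u \<in> set (T_nbrs r s t v) \<Longrightarrow> f v \<noteq> f u"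
    using assms(3) unfolding colorable_T_iff by metis
  \<comment> \<open>Unrolling the torus: (x, y) lies \<open>(x - 1) div r\<close> periods
    \<open>(r, t)\<close> away from the rows 1 to \<open>r\<close>, and each of them contributes a
    \<open>t\<close> to be subtracted.\<close>
  define c where "c x y = f (wrap r x, wrap s (y - t * ((x - 1) div r)))" for x y
  have V: "(wrap r x, wrap s y) \<in> {1..r} \<times> {1..s}" for x y
    using wrap_in[OF rs(1)] wrap_in[OF rs(2)] by auto
  have wp: "wrap n (y + n) = wrap n y" for n y :: int
    unfolding wrap_def using mod_add_self2[of "y - 1" n] by (simp add: algebra_simps)
  have up: "c (x + 1) y \<noteq> c x y \<and> c (x + 1) y \<noteq> c x (y + 1)" for x y
  proof -
    define d where "d = (x - 1) div r"
    define z where "z = y - t * d"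
    have xd: "x = wrap r x + r * d" using wrap_decomp[of x r] by (simp add: d_def)
    have wx: "1 \<le> wrap r x" "wrap r x \<le> r" using wrap_in[OF rs(1), of x] by auto
    have ws: "wrap s (wrap s p - a - b) = wrap s (p - a - b)" for p a b
      using wrap_shift(2)[of s p "a + b"] by (simp add: diff_diff_eq)
    show ?thesis
    \<comment> \<open>Only the step from row \<open>r\<close> to row 1 crosses the seam, where the
      twist by \<open>t\<close> enters.\<close>
    proof (cases "wrap r x = r")
      case True
      have d': "(x + 1 - 1) div r = d + 1" and w': "wrap r (x + 1) = 1"
      proof -
        have x: "x = r * (d + 1)" by (subst xd) (simp add: True algebra_simps)
        show "(x + 1 - 1) div r = d + 1" "wrap r (x + 1) = 1"
          unfolding wrap_def x using rs by simp_all
      qed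
      have c1: "c (x + 1) y = f (1, wrap s (z - t))"
        unfolding c_def d' w' by (simp add: z_def algebra_simps)
      have c2: "c x y = f (r, wrap s z)" "c x (y + 1) = f (r, wrap s (z + 1))"
        unfolding c_def d_def[symmetric] True by (simp_all add: z_def algebra_simps)
      have v: "(r, wrap s z) \<in> {1..r} \<times> {1..s}" "(r, wrap s (z + 1)) \<in> {1..r} \<times> {1..s}"
        using V[of x] True by auto
      have "(1, wrap s (z - t)) \<in> set (T_nbrs r s t (r, wrap s z))"
        "(1, wrap s (z - t)) \<in> set (T_nbrs r s t (r, wrap s (z + 1)))"
      proof -
        consider "r = 1" | "r > 1" using rs by linarith
        then show "(1, wrap s (z - t)) \<in> set (T_nbrs r s t (r, wrap s z))"
          by cases (simp_all add: T_nbrs_simps(1,3) wrap_shift)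
        consider "r = 1" | "r > 1" using rs by linarith
        then show "(1, wrap s (z - t)) \<in> set (T_nbrs r s t (r, wrap s (z + 1)))"
        proof cases
          case 1
          have "wrap s (wrap s (z + 1) - (t + 1)) = wrap s (z - t)" by (simp add: wrap_shift)
          then show ?thesis unfolding 1 T_nbrs_simps(1) by simp
        next
          case 2
          then show ?thesis by (simp add: T_nbrs_simps(3) ws)
        qed
      qed
      then show ?thesis using ne[OF v(1)] ne[OF v(2)] unfolding c1 c2 by metis
    next
      case False
      then have l: "wrap r x < r" using wx by simp
      have d': "(x + 1 - 1) div r = d" and w': "wrap r (x + 1) = wrap r x + 1"
      proof -
        have "(w + r * d) div r = d \<and> wrap r (w + r * d + 1) = w + 1" if "1 \<le> w" "w < r" for w
          using that rs by (simp add: wrap_def div_pos_pos_trivial mod_pos_pos_trivial)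
        from this[OF wx(1) l] show "(x + 1 - 1) div r = d" "wrap r (x + 1) = wrap r x + 1"
          unfolding xd[symmetric] by simp_all
      qed
      have c1: "c (x + 1) y = f (wrap r x + 1, wrap s z)"
        unfolding c_def d' w' by (simp add: z_def)
      have c2: "c x y = f (wrap r x, wrap s z)" "c x (y + 1) = f (wrap r x, wrap s (z + 1))"
        unfolding c_def d_def[symmetric] by (simp_all add: z_def algebra_simps)
      have "(wrap r x + 1, wrap s z) \<in> set (T_nbrs r s t (wrap r x, wrap s z))"
        "(wrap r x + 1, wrap s z) \<in> set (T_nbrs r s t (wrap r x, wrap s (z + 1)))"
      proof -
        consider "wrap r x = 1" | "wrap r x > 1" using wx by linarith
        then show "(wrap r x + 1, wrap s z) \<in> set (T_nbrs r s t (wrap r x, wrap s z))"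
          using l wrap_shift(1)[of s z 0] by cases (simp_all add: T_nbrs_simps(2,4) wrap_shift)
        consider "wrap r x = 1" | "wrap r x > 1" using wx by linarith
        then show "(wrap r x + 1, wrap s z) \<in> set (T_nbrs r s t (wrap r x, wrap s (z + 1)))"
          using l wrap_shift(1)[of s z 0] by cases (simp_all add: T_nbrs_simps(2,4) wrap_shift)
      qed
      then show ?thesis using ne[OF V[of x z]] ne[OF V[of x "z + 1"]] unfolding c1 c2 by metis
    qed
  qed
  have side: "c x (y + 1) \<noteq> c x y" for x y
  proof -
    define z where "z = y - t * ((x - 1) div r)"
    have wx: "1 \<le> wrap r x" "wrap r x \<le> r" using wrap_in[OF rs(1), of x] by auto
    have c2: "c x y = f (wrap r x, wrap s z)" "c x (y + 1) = f (wrap r x, wrap s (z + 1))"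
      unfolding c_def by (simp_all add: z_def algebra_simps)
    consider "r = 1" "wrap r x = 1" | "r > 1" "wrap r x = 1" | "r > 1" "wrap r x = r" | "1 < wrap r x" "wrap r x < r"
      using wx by linarith
    then have "(wrap r x, wrap s (z + 1)) \<in> set (T_nbrs r s t (wrap r x, wrap s z))"
      by cases (simp_all add: T_nbrs_simps wrap_shift)
    then show ?thesis using ne[OF V[of x z]] unfolding c2 by metis
  qed
  have "c x (y + s) = c x y" for x y
    using wp[of s "y - t * ((x - 1) div r)"] by (simp add: c_def algebra_simps)
  moreover have "c (x + r) (y + t) = c x y" for x y
  proof -
    have "(x + r - 1) div r = (x - 1) div r + 1"
      using div_add_self2[of r "x - 1"] rs by (simp add: algebra_simps)
    then show ?thesis using wp[of r x] by (simp add: c_def algebra_simps)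
  qed
  moreover have "c x y < k" for x y unfolding c_def using f V by blast
  ultimately show ?thesis using that[of c] up side unfolding lattice_coloring_def by auto
qed

section \<open>Colourings from characters\<close>

text \<open>For n > 0: the fraction z / n is at distance at least 1 / q from every integer.\<close>

definition spread :: "int \<Rightarrow> int \<Rightarrow> int \<Rightarrow> bool" where
  "spread q n z \<longleftrightarrow> n \<le> q * (z mod n) \<and> q * (z mod n) \<le> (q - 1) * n"

lemma spread_uminus:
  assumes "n > 0" "spread q n z"
  shows "spread q n (- z)"
proof (cases "z mod n = 0")
  case True then show ?thesis using assms by (auto simp: spread_def)
next
  case False
  then show ?thesis using assms by (auto simp: spread_def zmod_zminus1_eq_if algebra_simps)
qed

text \<open>Two points of the same half-open arc differ by less than 1 / q, whereas a spread step
  moves by at least that much in both directions round the circle; these are the two alternatives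
  for \<open>b\<close>.\<close>

lemma spread_distinct:
  fixes n q x z :: int
  assumes "n > 0" "q > 0" "spread q n z"
  shows "(q * ((x + z) mod n)) div n \<noteq> (q * (x mod n)) div n"
proof
  assume eq: "(q * ((x + z) mod n)) div n = (q * (x mod n)) div n"
  define a b w where "a = x mod n" and "b = (x + z) mod n" and "w = z mod n"
  have rng: "0 \<le> a" "a < n" "0 \<le> b" "b < n" "0 \<le> w" "w < n"
    using assms(1) by (auto simp: a_def b_def w_def)
  have "b = (a + w) mod n" by (simp add: a_def b_def w_def mod_simps)
  then have b: "b = a + w \<or> b = a + w - n"
    using rng mod_pos_pos_trivial[of "a + w" n] mod_pos_pos_trivial[of "a + w - n" n]
      minus_mod_self2[of "a + w" n] by linarith
  have "\<bar>q * b - q * a\<bar> < n"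
  proof -
    have "q * b - q * a = (q * b) mod n - (q * a) mod n"
      using eq unfolding a_def[symmetric] b_def[symmetric] by (simp flip: minus_mult_div_eq_mod)
    moreover have "0 \<le> (q * b) mod n" "(q * b) mod n < n" "0 \<le> (q * a) mod n" "(q * a) mod n < n"
      using assms(1) by simp_all
    ultimately show ?thesis by linarith
  qed
  moreover have "n \<le> q * w" "q * w \<le> q * n - n"
    using assms(3) by (auto simp: spread_def w_def algebra_simps)
  moreover have "q * b = q * a + q * w \<or> q * b = q * a + q * w - q * n"
    using b by (elim disjE) (simp_all only: distrib_left right_diff_distrib simp_thms)
  ultimately show False by linarith
qed

text \<open>The character is (A x + B y) / n modulo 1 and the colour is the index of the arc that
  contains it. The condition \<open>per\<close> says that it kills \<open>(0, s)\<close> and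
  \<open>(r, t)\<close>.\<close>

lemma lattice_coloring_character:
  fixes q n A B :: int
  assumes "n > 0" "q > 0" and per: "n dvd s * B" "n dvd r * A + t * B"
    and sp: "spread q n A" "spread q n B" "spread q n (A - B)"
  shows "lattice_coloring (nat q) r s t (\<lambda>x y. nat ((q * ((A * x + B * y) mod n)) div n))"
proof -
  let ?g = "\<lambda>z. (q * (z mod n)) div n"
  have pos: "?g z \<ge> 0" "?g z < q" for z
  proof -
    have "0 \<le> q * (z mod n)" using assms by simp
    then show "?g z \<ge> 0" using assms(1) by (simp add: pos_imp_zdiv_nonneg_iff)
    have "q * (z mod n) < n * q" using assms by (simp add: mult.commute)
    moreover have "n * ?g z \<le> q * (z mod n)"
      using mult_div_mod_eq[of n "q * (z mod n)"] pos_mod_sign[OF assms(1), of "q * (z mod n)"] by linarith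
    ultimately have "n * ?g z < n * q" by linarith
    then show "?g z < q" using assms(1) by simp
  qed
  have eq: "nat (?g a) = nat (?g b) \<longleftrightarrow> ?g a = ?g b" for a b using pos by (simp add: nat_eq_iff)
  have p: "?g (z + w) = ?g z" if "n dvd w" for z w
    using that by (metis add.right_neutral dvd_imp_mod_0 mod_add_right_eq)
  have d: "?g (z + w) \<noteq> ?g z" if "spread q n w" for z w
    using spread_distinct[OF assms(1,2) that] .
  show ?thesis unfolding lattice_coloring_def eq
  proof (intro allI conjI)
    fix x y
    show "nat (?g (A * x + B * y)) < nat q" using pos assms(2) by simp
    show "?g (A * x + B * (y + s)) = ?g (A * x + B * y)"
      using p[OF per(1), of "A * x + B * y"] by (simp add: algebra_simps)
    show "?g (A * (x + r) + B * (y + t)) = ?g (A * x + B * y)"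
      using p[OF per(2), of "A * x + B * y"] by (simp add: algebra_simps)
    show "?g (A * (x + 1) + B * y) \<noteq> ?g (A * x + B * y)"
      using d[OF sp(1), of "A * x + B * y"] by (simp add: algebra_simps)
    show "?g (A * x + B * (y + 1)) \<noteq> ?g (A * x + B * y)"
      using d[OF sp(2), of "A * x + B * y"] by (simp add: algebra_simps)
    show "?g (A * (x + 1) + B * y) \<noteq> ?g (A * x + B * (y + 1))"
      using d[OF sp(3), of "A * x + B * (y + 1)"] by (simp add: algebra_simps)
  qed
qed

text \<open>Stated for an arbitrary pair of vectors instead of \<open>(r, t)\<close> and
  \<open>(0, s)\<close>, so that bases can be changed and the symmetries of the lattice can
  act.\<close>

definition good :: "int \<Rightarrow> int \<Rightarrow> int \<times> int \<Rightarrow> int \<times> int \<Rightarrow> bool" where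
  "good q n u v \<longleftrightarrow> (\<exists>A B. n dvd A * fst u + B * snd u \<and> n dvd A * fst v + B * snd v \<and>
     spread q n A \<and> spread q n B \<and> spread q n (A - B))"

lemma spreadI:
  assumes "n > 0" "n \<le> q * z" "q * z \<le> (q - 1) * n" "q > 0"
  shows "spread q n z"
proof -
  have "q * z < q * n" using assms(1,3) left_diff_distrib[of q 1 n] by linarith
  then have "z < n" using assms(4) by simp
  moreover have "z \<ge> 0" using assms by (smt (verit) mult_nonneg_nonpos)
  ultimately show ?thesis using assms by (simp add: spread_def mod_pos_pos_trivial)
qed

text \<open>The last hypothesis says that the interval from a / b to c / d has length at least
  1.\<close>

lemma ex_int_between:
  fixes a b c d :: int
  assumes "b > 0" "d > 0" "c * b - a * d \<ge> b * d"
  shows "\<exists>l. a \<le> b * l \<and> d * l \<le> c"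
proof (intro exI conjI)
  let ?l = "c div d"
  show "d * ?l \<le> c" using assms(2) using mult_div_mod_eq[of d c] pos_mod_sign[of d c] by linarith
  have "c < d * ?l + d" using assms(2) using mult_div_mod_eq[of d c] pos_mod_bound[of d c] by linarith
  then have "c * b < (d * ?l + d) * b" using assms(1) by simp
  then have "a * d < d * (b * ?l)" using assms(3) by (simp add: algebra_simps)
  then show "a \<le> b * ?l" using assms(2) by (simp add: mult.commute)
qed

text \<open>The linear forms taking the values \<open>k\<close> at \<open>(a, b)\<close> and \<open>l\<close> at \<open>v\<close>, scaled by \<open>n\<close>, are
  \<open>(A, B) = (k v\<^sub>2 - l b, l a - k v\<^sub>1)\<close>; all three spread conditions are linear in \<open>l\<close>.\<close>

lemma good_of_interval:
  fixes a b k l q n v1 v2 :: int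
  assumes "n > 0" "q \<ge> 2" and n: "n = a * v2 - b * v1"
    and "n \<le> q * (k * v2 - l * b)" "n \<le> q * (k * v1 - l * a)"
    and "q * (k * (v1 + v2) - l * (a + b)) \<le> (q - 1) * n"
  shows "good q n (a, b) (v1, v2)"
  unfolding good_def
proof (intro exI conjI)
  let ?A = "k * v2 - l * b" and ?B = "l * a - k * v1"
  have s: "q * ?A + q * (- ?B) \<le> (q - 1) * n" using assms(6) by (simp add: algebra_simps)
  have "?A * a + ?B * b = n * k" "?A * v1 + ?B * v2 = n * l" by (simp_all add: n algebra_simps)
  then show "n dvd ?A * fst (a, b) + ?B * snd (a, b)" "n dvd ?A * fst (v1, v2) + ?B * snd (v1, v2)"
    by simp_all
  show "spread q n ?A" using assms s by (intro spreadI) (auto simp: algebra_simps)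
  have "spread q n (- ?B)" using assms s by (intro spreadI) (auto simp: algebra_simps)
  then show "spread q n ?B" using spread_uminus[OF assms(1)] by fastforce
  show "spread q n (?A - ?B)" using assms s by (intro spreadI) (auto simp: algebra_simps)
qed

text \<open>Here k lies between the corner values (a - b) / q and ((q - 2) a - b) / q, so the line
  runs from the side - B = n / q to the side A - B = (q - 1) n / q. These sides bound
  \<open>l\<close> from above and from below, and the second inequality of \<open>k\<close> makes
  the interval for \<open>l\<close> at least 1 long.\<close>

lemma good_right:
  fixes a b k q n v1 v2 :: int
  assumes "n > 0" "q \<ge> 2" and n: "n = a * v2 - b * v1" and ab: "a > 0" "b \<ge> 0"
    and k: "a - b \<le> q * k" "q * a * (a + b) \<le> n * ((q - 2) * a - b - q * k)"
  shows "good q n (a, b) (v1, v2)"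
proof -
  have "\<exists>l. q * k * (v1 + v2) - (q - 1) * n \<le> (q * (a + b)) * l \<and> (q * a) * l \<le> q * k * v1 - n"
  proof (rule ex_int_between)
    have "(q * k * v1 - n) * (q * (a + b)) - (q * k * (v1 + v2) - (q - 1) * n) * (q * a)
        = q * (n * ((q - 2) * a - b - q * k))"
      unfolding n by (simp add: algebra_simps)
    also have "\<dots> \<ge> q * (q * a * (a + b))" using k(2) assms(2) by simp
    finally show "q * (a + b) * (q * a) \<le> (q * k * v1 - n) * (q * (a + b)) - (q * k * (v1 + v2) - (q - 1) * n) * (q * a)"
      by (simp add: algebra_simps)
  qed (use assms in auto)
  then obtain l where l: "q * k * (v1 + v2) - (q - 1) * n \<le> (q * (a + b)) * l" "(q * a) * l \<le> q * k * v1 - n"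
    by blast
  \<comment> \<open>The third side, A >= n / q, needs no extra bound on \<open>l\<close>: it follows
    from the bound on B because k is at least (a - b) / q.\<close>
  have "(q * k * v2 - n - q * l * b) * a - (q * k * v1 - n - q * l * a) * b = n * (q * k - (a - b))"
    unfolding n by (simp add: algebra_simps)
  moreover have "(q * k * v1 - n - q * l * a) * b \<ge> 0"
    using l(2) ab by (intro mult_nonneg_nonneg) (simp_all add: algebra_simps)
  moreover have "n * (q * k - (a - b)) \<ge> 0" using k(1) assms(1) by simp
  ultimately have "(q * k * v2 - n - q * l * b) * a \<ge> 0" by linarith
  then have "q * k * v2 - n - q * l * b \<ge> 0" using ab by (simp add: zero_le_mult_iff)
  then show ?thesis
    using l by (intro good_of_interval[OF assms(1-3), of k l]) (simp_all add: algebra_simps)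
qed

text \<open>Now k lies on the other side of the corner value (a - b) / q, so the line starts from
  the side A = n / q, and the bound on B is the implied one.\<close>

lemma good_left:
  fixes a b k q n v1 v2 :: int
  assumes "n > 0" "q \<ge> 2" and n: "n = a * v2 - b * v1" and ab: "a > 0" "b > 0"
    and k: "q * k \<le> a - b" "q * b * (a + b) \<le> n * (q * k - a + (q - 2) * b)"
  shows "good q n (a, b) (v1, v2)"
proof -
  have "\<exists>l. q * k * (v1 + v2) - (q - 1) * n \<le> (q * (a + b)) * l \<and> (q * b) * l \<le> q * k * v2 - n"
  proof (rule ex_int_between)
    have "(q * k * v2 - n) * (q * (a + b)) - (q * k * (v1 + v2) - (q - 1) * n) * (q * b)
        = q * (n * (q * k - a + (q - 2) * b))"
      unfolding n by (simp add: algebra_simps)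
    also have "\<dots> \<ge> q * (q * b * (a + b))" using k(2) assms(2) by simp
    finally show "q * (a + b) * (q * b) \<le> (q * k * v2 - n) * (q * (a + b)) - (q * k * (v1 + v2) - (q - 1) * n) * (q * b)"
      by (simp add: algebra_simps)
  qed (use assms in auto)
  then obtain l where l: "q * k * (v1 + v2) - (q - 1) * n \<le> (q * (a + b)) * l" "(q * b) * l \<le> q * k * v2 - n"
    by blast
  have "(q * k * v1 - n - q * l * a) * b - (q * k * v2 - n - q * l * b) * a = n * ((a - b) - q * k)"
    unfolding n by (simp add: algebra_simps)
  moreover have "(q * k * v2 - n - q * l * b) * a \<ge> 0"
    using l(2) ab by (intro mult_nonneg_nonneg) (simp_all add: algebra_simps)
  moreover have "n * ((a - b) - q * k) \<ge> 0" using k(1) assms(1) by simp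
  ultimately have "(q * k * v1 - n - q * l * a) * b \<ge> 0" by linarith
  then have "q * k * v1 - n - q * l * a \<ge> 0" using ab by (simp add: zero_le_mult_iff)
  then show ?thesis
    using l by (intro good_of_interval[OF assms(1-3), of k l]) (simp_all add: algebra_simps)
qed

text \<open>The squared Euclidean length when (1, 0) and (0, 1) are drawn as unit vectors at an
  angle of 60 degrees; (1, -1) is then a unit vector as well.\<close>

definition hex_norm :: "int \<times> int \<Rightarrow> int" where
  "hex_norm u = fst u * fst u + fst u * snd u + snd u * snd u"

text \<open>The origin of 56: for (6, 1), of norm 43, the only usable line is k = 2, which asks for
  168 <= 3 n. The maximum is the least value left for n, as a shortest vector has norm at most
  n.\<close>

lemma good4_small_sector:
  "\<forall>a \<in> set [1..7]. \<forall>b \<in> set [0..a]. a * a + a * b + b * b \<notin> set [1, 4, 7] \<longrightarrow>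
     (\<exists>k \<in> set [0..2]. a - b \<le> 4 * k \<and> 4 * a * (a + b) \<le> max 56 (a * a + a * b + b * b) * (2 * a - b - 4 * k) \<or>
        b > 0 \<and> 4 * k \<le> a - b \<and> 4 * b * (a + b) \<le> max 56 (a * a + a * b + b * b) * (4 * k - a + 2 * b))"
  by code_simp

lemma good4_sector:
  fixes a b n v1 v2 :: int
  assumes n: "n \<ge> 56" "n = a * v2 - b * v1" and ab: "a > 0" "b \<ge> 0" "b \<le> a"
    and N: "hex_norm (a, b) \<le> n" "hex_norm (a, b) \<notin> {1, 4, 7}"
  shows "good 4 n (a, b) (v1, v2)"
proof -
  have R: "good 4 n (a, b) (v1, v2)" if "a - b \<le> 4 * k" "4 * a * (a + b) \<le> n * (2 * a - b - 4 * k)" for k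
    using good_right[of n 4 a v2 b v1 k] n ab that by simp
  have L: "good 4 n (a, b) (v1, v2)" if "b > 0" "4 * k \<le> a - b" "4 * b * (a + b) \<le> n * (4 * k - a + 2 * b)" for k
    using good_left[of n 4 a v2 b v1 k] n ab that by simp
  show ?thesis
  proof (cases "a \<ge> 8")
    case True
    \<comment> \<open>The ceiling of (a - b) / 4. It gives 2 a - b - 4 k >= a - 3 >= 5, which is
      matched by 4 a (a + b) being at most 5 times the norm.\<close>
    define k where "k = (a - b + 3) div 4"
    have k: "a - b \<le> 4 * k" "4 * k \<le> a - b + 3" unfolding k_def by presburger+
    have "5 * hex_norm (a, b) = 4 * a * (a + b) + (a * a + a * b + 5 * (b * b))"
      by (simp add: hex_norm_def algebra_simps)
    moreover have "a * a + a * b + 5 * (b * b) \<ge> 0" using ab by simp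
    ultimately have "4 * a * (a + b) \<le> 5 * hex_norm (a, b)" by linarith
    also have "\<dots> \<le> 5 * n" using N by simp
    also have "\<dots> \<le> (2 * a - b - 4 * k) * n"
      by (rule mult_right_mono) (use k True n in auto)
    finally show ?thesis using R[OF k(1)] by (simp add: mult.commute)
  next
    case False
    then have "a \<in> set [1..7]" "b \<in> set [0..a]" "a * a + a * b + b * b \<notin> set [1, 4, 7]"
      using ab N(2) by (auto simp: hex_norm_def)
    then obtain k where "a - b \<le> 4 * k \<and> 4 * a * (a + b) \<le> max 56 (a * a + a * b + b * b) * (2 * a - b - 4 * k) \<or>
        b > 0 \<and> 4 * k \<le> a - b \<and> 4 * b * (a + b) \<le> max 56 (a * a + a * b + b * b) * (4 * k - a + 2 * b)"
      using good4_small_sector by blast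
    \<comment> \<open>The finite check is made at the least possible n. A positive \<open>p\<close>
      forces \<open>d\<close> to be nonnegative, so the inequality persists for larger n.\<close>
    moreover have "max 56 (a * a + a * b + b * b) * d \<ge> p \<Longrightarrow> p > 0 \<Longrightarrow> n * d \<ge> p" for d p
    proof -
      assume p: "max 56 (a * a + a * b + b * b) * d \<ge> p" "p > 0"
      then have "d \<ge> 0" by (smt (verit) mult_nonneg_nonpos)
      then have "max 56 (a * a + a * b + b * b) * d \<le> n * d"
        using n(1) N(1) by (intro mult_right_mono) (simp_all add: hex_norm_def)
      then show "n * d \<ge> p" using p by linarith
    qed
    ultimately show ?thesis using R[of k] L[of k] ab by auto
  qed
qed

section \<open>Symmetries of the triangular lattice\<close>

lemma good_swap:
  assumes "n > 0" "good q n (y, x) (w, z)"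
  shows "good q n (x, y) (z, w)"
proof -
  obtain A B where AB: "n dvd A * y + B * x" "n dvd A * w + B * z" "spread q n A" "spread q n B"
    "spread q n (A - B)"
    using assms(2) by (auto simp: good_def)
  have "spread q n (B - A)" using spread_uminus[OF assms(1) AB(5)] by simp
  then show ?thesis unfolding good_def using AB by (intro exI[of _ B] exI[of _ A]) (simp add: add.commute)
qed

text \<open>Rotation by 60 degrees permutes the three steps up to sign; on characters it acts as (A,
  B) to (A - B, A).\<close>

lemma good_rotate:
  assumes "n > 0" "good q n (x, y) (z, w)"
  shows "good q n (- y, x + y) (- w, z + w)"
proof -
  obtain A B where AB: "n dvd A * x + B * y" "n dvd A * z + B * w" "spread q n A" "spread q n B"
    "spread q n (A - B)"
    using assms(2) by (auto simp: good_def)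
  have "spread q n (- B)" using spread_uminus[OF assms(1) AB(4)] .
  then show ?thesis unfolding good_def using AB
    by (intro exI[of _ "A - B"] exI[of _ A]) (simp add: algebra_simps)
qed

lemma good_uminus:
  "good q n (- x, - y) v \<longleftrightarrow> good q n (x, y) v"
  "good q n v (- x, - y) \<longleftrightarrow> good q n v (x, y)"
proof -
  have "n dvd A * - x + B * - y \<longleftrightarrow> n dvd A * x + B * y" for A B
    using dvd_minus_iff[of n "A * x + B * y"] by (simp add: algebra_simps)
  then show "good q n (- x, - y) v \<longleftrightarrow> good q n (x, y) v"
    "good q n v (- x, - y) \<longleftrightarrow> good q n v (x, y)"
    by (simp_all add: good_def)
qed

text \<open>The twelve symmetries of the triangular lattice carry every vector into the sector
  \<open>0 \<le> b \<le> a\<close>.\<close>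

lemma good_of_sector:
  assumes n: "n > 0"
    and sector: "\<And>a b v1 v2. a > 0 \<Longrightarrow> b \<ge> 0 \<Longrightarrow> b \<le> a \<Longrightarrow> a * v2 - b * v1 = n \<Longrightarrow>
      hex_norm (a, b) \<in> S \<Longrightarrow> good q n (a, b) (v1, v2)"
    and "hex_norm (x, y) \<in> S" "\<bar>x * w - y * z\<bar> = n"
  shows "good q n (x, y) (z, w)"
proof -
  have sec: "good q n (x, y) (z, w)"
    if "y \<ge> 0" "y \<le> x" "hex_norm (x, y) \<in> S" "\<bar>x * w - y * z\<bar> = n" for x y z w
  proof -
    have "x > 0" using that n by (cases "x = 0") auto
    then show ?thesis
      using sector[of x y w z] sector[of x y "- w" "- z"] good_uminus(2)[of q n "(x, y)" z w] that
      by (cases "x * w - y * z \<ge> 0") auto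
  qed
  have quad: "good q n (x, y) (z, w)"
    if "x \<ge> 0" "y \<ge> 0" "hex_norm (x, y) \<in> S" "\<bar>x * w - y * z\<bar> = n" for x y z w
  proof (cases "y \<le> x")
    case False
    have "hex_norm (y, x) \<in> S" using that(3) by (simp add: hex_norm_def algebra_simps)
    moreover have "\<bar>y * z - x * w\<bar> = n" using that(4) by (simp add: abs_minus_commute)
    ultimately show ?thesis using good_swap[OF n sec[where x = y and y = x and z = w and w = z]] that False by simp
  qed (use sec that in blast)
  have rot: "good q n (x, y) (z, w)" if "good q n (x + y, - x) (z + w, - z)" for x y z w
    using good_rotate[OF n that] by simp
  have rotS: "hex_norm (x + y, - x) = hex_norm (x, y)" for x y
    by (simp add: hex_norm_def algebra_simps)
  have rotd: "(x + y) * (- z) - (- x) * (z + w) = x * w - y * z" for x y z w :: int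
    by (simp add: algebra_simps)
  have half: "good q n (x, y) (z, w)"
    if "y \<ge> 0" "hex_norm (x, y) \<in> S" "\<bar>x * w - y * z\<bar> = n" for x y z w
  proof -
    consider "x \<ge> 0" | "x < 0" "x + y \<ge> 0" | "x < 0" "x + y < 0" by linarith
    then show ?thesis
    proof cases
      case 1
      then show ?thesis using quad that by blast
    next
      case 2
      have "good q n (x + y, - x) (z + w, - z)"
        using 2 that rotS[of x y] rotd[of x y z w] by (intro quad) simp_all
      then show ?thesis by (rule rot)
    next
      case 3
      have "hex_norm (y, - (x + y)) = hex_norm (x, y)" "y * - (z + w) - - (x + y) * w = x * w - y * z"
        by (simp_all add: hex_norm_def algebra_simps)
      then have "good q n (y, - (x + y)) (w, - (z + w))"
        using 3 that by (intro quad) simp_all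
      then have "good q n (x + y, - x) (z + w, - z)"
        using good_rotate[OF n, of q y "- (x + y)" w "- (z + w)"] by (simp add: add.commute)
      then show ?thesis by (rule rot)
    qed
  qed
  show ?thesis
  proof (cases "y \<ge> 0")
    case False
    have "good q n (- x, - y) (z, w)"
      using False assms(3,4) by (intro half) (auto simp: hex_norm_def abs_minus_commute)
    then show ?thesis by (simp add: good_uminus)
  qed (use half assms(3,4) in blast)
qed

lemma good4:
  assumes "n \<ge> 56" "\<bar>x * w - y * z\<bar> = n" "hex_norm (x, y) \<le> n" "hex_norm (x, y) \<notin> {1, 4, 7}"
  shows "good 4 n (x, y) (z, w)"
proof (rule good_of_sector[where S = "{k. k \<le> n \<and> k \<notin> {1, 4, 7}}"])
  fix a b v1 v2 :: int
  assume "a > 0" "b \<ge> 0" "b \<le> a" "a * v2 - b * v1 = n" "hex_norm (a, b) \<in> {k. k \<le> n \<and> k \<notin> {1, 4, 7}}"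
  then show "good 4 n (a, b) (v1, v2)" using assms(1) by (intro good4_sector) simp_all
qed (use assms in simp_all)

text \<open>In the sector, norms 4 and 7 occur only at (2, 0) and (2, 1). With q = 5 the corners of
  the triangle move off the lines, and the longer requirement, for (2, 0), is n >= 20.\<close>

lemma good5_sector:
  fixes a b n v1 v2 :: int
  assumes n: "n \<ge> 20" "n = a * v2 - b * v1" and ab: "a > 0" "b \<ge> 0" "b \<le> a"
    and N: "hex_norm (a, b) \<in> {4, 7}"
  shows "good 5 n (a, b) (v1, v2)"
proof -
  have "a * b \<ge> 0" "b * b \<ge> 0" using ab by simp_all
  moreover have "hex_norm (a, b) \<le> 7" using N by auto
  ultimately have "a * a \<le> 7" unfolding hex_norm_def fst_conv snd_conv by linarith
  then have "\<not> 3 \<le> a" using mult_mono[of 3 a 3 a] by linarith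
  then have "a = 1 \<or> a = 2" "b = 0 \<or> b = 1 \<or> b = 2" using ab by linarith+
  then have "(a, b) = (2, 0) \<or> (a, b) = (2, 1)"
    using N ab(3) by (elim disjE) (simp_all add: hex_norm_def)
  then show ?thesis
  proof
    assume "(a, b) = (2, 0)"
    then show ?thesis using n good_right[of n 5 2 v2 0 v1 1] by simp
  next
    assume "(a, b) = (2, 1)"
    then show ?thesis using n good_left[of n 5 2 v2 1 v1 0] by simp
  qed
qed

lemma good5:
  assumes "n \<ge> 20" "\<bar>x * w - y * z\<bar> = n" "hex_norm (x, y) \<in> {4, 7}"
  shows "good 5 n (x, y) (z, w)"
proof (rule good_of_sector[where S = "{4, 7}"])
  fix a b v1 v2 :: int
  assume "a > 0" "b \<ge> 0" "b \<le> a" "a * v2 - b * v1 = n" "hex_norm (a, b) \<in> {4, 7}"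
  then show "good 5 n (a, b) (v1, v2)" using assms(1) by (intro good5_sector) simp_all
qed (use assms in simp_all)

section \<open>Reduction to a short basis of the period lattice\<close>

definition in_lattice :: "int \<Rightarrow> int \<Rightarrow> int \<Rightarrow> int \<Rightarrow> int \<Rightarrow> bool" where
  "in_lattice r s t x y \<longleftrightarrow> r dvd x \<and> s dvd y - t * (x div r)"

text \<open>A character that kills one basis of the lattice kills every basis; the two combinations
  in the proof invert the unimodular matrix with rows (i, j) and (k, l).\<close>

lemma good_basis_change:
  assumes "good q n (r * i, t * i + s * j) (r * k, t * k + s * l)" "i * l - j * k = 1"
  shows "good q n (0, s) (r, t)"
proof -
  obtain A B where AB: "n dvd A * (r * i) + B * (t * i + s * j)" "n dvd A * (r * k) + B * (t * k + s * l)"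
    "spread q n A" "spread q n B" "spread q n (A - B)"
    using assms(1) by (auto simp: good_def)
  have "B * s * (i * l - j * k)
      = i * (A * (r * k) + B * (t * k + s * l)) - k * (A * (r * i) + B * (t * i + s * j))"
    by (simp add: algebra_simps)
  then have "B * s = i * (A * (r * k) + B * (t * k + s * l)) - k * (A * (r * i) + B * (t * i + s * j))"
    using assms(2) by simp
  then have 1: "n dvd B * s" using AB(1,2) by simp
  have "(A * r + B * t) * (i * l - j * k)
      = l * (A * (r * i) + B * (t * i + s * j)) - j * (A * (r * k) + B * (t * k + s * l))"
    by (simp add: algebra_simps)
  then have "A * r + B * t
      = l * (A * (r * i) + B * (t * i + s * j)) - j * (A * (r * k) + B * (t * k + s * l))"
    using assms(2) by simp
  then have "n dvd A * r + B * t" using AB(1,2) by simp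
  then show ?thesis using 1 AB unfolding good_def by auto
qed

lemma lattice_coloring_of_good:
  assumes "n > 0" "q > 0" "good q n (0, s) (r, t)"
  shows "\<exists>c. lattice_coloring (nat q) r s t c"
proof -
  obtain A B where "n dvd A * 0 + B * s" "n dvd A * r + B * t"
    "spread q n A" "spread q n B" "spread q n (A - B)"
    using assms(3) by (auto simp: good_def)
  then show ?thesis
    using lattice_coloring_character[OF assms(1,2), of s B r A t] by (auto simp: mult.commute)
qed

text \<open>The size reduction for \<open>short_basis\<close>: adding m times u to v changes twice
  their inner product by 2 m times the norm of u.\<close>

lemma ex_centered_residue:
  fixes a m :: int
  assumes "m > 0"
  shows "\<exists>k. \<bar>a + 2 * k * m\<bar> \<le> m"
proof -
  let ?c = "(a + m) mod (2 * m)"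
  have "?c - m = a + 2 * (- ((a + m) div (2 * m))) * m"
    using minus_mult_div_eq_mod[of "a + m" "2 * m"] by (simp add: algebra_simps)
  moreover have "\<bar>?c - m\<bar> \<le> m"
    using pos_mod_sign[of "2 * m" "a + m"] pos_mod_bound[of "2 * m" "a + m"] assms by linarith
  ultimately show ?thesis by metis
qed

lemma hex_norm_nonneg: "hex_norm u \<ge> 0"
proof -
  have "2 * hex_norm u = (fst u + snd u)\<^sup>2 + (fst u)\<^sup>2 + (snd u)\<^sup>2"
    by (simp add: hex_norm_def power2_eq_square algebra_simps)
  then show ?thesis by (smt (verit) zero_le_power2)
qed

lemma hex_norm_pos: "u \<noteq> (0, 0) \<Longrightarrow> hex_norm u > 0"
proof -
  assume "u \<noteq> (0, 0)"
  then have "fst u \<noteq> 0 \<or> snd u \<noteq> 0" by (cases u) auto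
  then have "(fst u)\<^sup>2 > 0 \<or> (snd u)\<^sup>2 > 0" by auto
  moreover have "2 * hex_norm u = (fst u + snd u)\<^sup>2 + (fst u)\<^sup>2 + (snd u)\<^sup>2"
    by (simp add: hex_norm_def power2_eq_square algebra_simps)
  ultimately show ?thesis by (smt (verit) zero_le_power2)
qed

text \<open>Gauss reduction. A shortest vector u is primitive, so Bezout completes it to a basis u,
  v, and adding a multiple of u to v makes \<open>\<beta>\<close>, twice the inner product, at most
  N(u) in absolute value. The identity 4 N(u) N(v) = \<beta>^2 + 3 (r s)^2 together with N(u) <=
  N(v) then yields N(u) <= r s.\<close>

lemma short_basis:
  fixes r s t :: int
  assumes "r \<ge> 1" "s \<ge> 1"
  obtains i j k l where "i * l - j * k = 1" "hex_norm (r * i, t * i + s * j) \<le> r * s"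
proof -
  define N where "N = (\<lambda>(i, j). hex_norm (r * i, t * i + s * j))"
  have Npos: "N p > 0" if "p \<noteq> (0, 0)" for p
  proof -
    obtain i j where p: "p = (i, j)" by (cases p)
    have "(r * i, t * i + s * j) \<noteq> (0, 0)" using that assms by (cases "i = 0") (simp_all add: p)
    then show ?thesis using hex_norm_pos by (simp add: N_def p)
  qed
  obtain i j where ij: "(i, j) \<noteq> (0, 0)" and least: "\<And>p. p \<noteq> (0, 0) \<Longrightarrow> N (i, j) \<le> N p"
  proof -
    have "\<exists>p. p \<noteq> (0, 0) \<and> (\<forall>p'. p' \<noteq> (0, 0) \<longrightarrow> nat (N p) \<le> nat (N p'))"
      by (rule ex_has_least_nat[where k = "(1, 0)"]) simp
    then obtain p where p: "p \<noteq> (0, 0)" "\<forall>p'. p' \<noteq> (0, 0) \<longrightarrow> nat (N p) \<le> nat (N p')"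
      by blast
    have "N p \<le> N p'" if "p' \<noteq> (0, 0)" for p'
      using p(2)[rule_format, OF that] Npos[OF that] by (simp add: nat_le_eq_zle)
    then show ?thesis using that[of "fst p" "snd p"] p(1) by simp
  qed
  have "coprime i j"
  proof -
    define g where "g = gcd i j"
    have "g > 0" using ij by (auto simp: g_def)
    obtain i' j' where e: "i = g * i'" "j = g * j'" unfolding g_def by (metis gcd_dvd1 gcd_dvd2 dvdE)
    have ne: "(i', j') \<noteq> (0, 0)" using ij e by auto
    have "N (i, j) = g * g * N (i', j')" by (simp add: N_def hex_norm_def e algebra_simps)
    then have "g * g * N (i', j') \<le> 1 * N (i', j')" using least[OF ne] by simp
    then have "g * g \<le> 1" using Npos[OF ne] by (simp only: mult_le_cancel_right_pos)
    moreover have "g * g \<ge> g * 1" using \<open>g > 0\<close> by (intro mult_left_mono) auto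
    ultimately have "g \<le> 1" by linarith
    then have "g = 1" using \<open>g > 0\<close> by simp
    then show ?thesis by (simp add: g_def coprime_iff_gcd_eq_1)
  qed
  then obtain a b where "a * i + b * j = 1" using bezout_int[of i j] by auto
  then have ab: "i * a - j * (- b) = 1" by (simp add: algebra_simps)
  define x y where "x = r * i" and "y = t * i + s * j"
  define z w where "z = r * (- b)" and "w = t * (- b) + s * a"
  obtain m where m: "\<bar>(2*x*z + x*w + y*z + 2*y*w) + 2 * m * hex_norm (x, y)\<bar> \<le> hex_norm (x, y)"
    using ex_centered_residue[of "hex_norm (x, y)"] Npos[OF ij] by (auto simp: N_def x_def y_def)
  define k l where "k = - b + m * i" and "l = a + m * j"
  have kl: "i * l - j * k = 1" using ab by (simp add: k_def l_def algebra_simps)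
  define z' w' where "z' = r * k" and "w' = t * k + s * l"
  have zw: "z' = z + m * x" "w' = w + m * y"
    by (simp_all add: z'_def w'_def z_def w_def x_def y_def k_def l_def algebra_simps)
  define \<beta> where "\<beta> = 2*x*z' + x*w' + y*z' + 2*y*w'"
  have "\<beta> = (2*x*z + x*w + y*z + 2*y*w) + 2 * m * hex_norm (x, y)"
    by (simp add: \<beta>_def zw hex_norm_def algebra_simps)
  then have bound: "\<bar>\<beta>\<bar> \<le> hex_norm (x, y)" using m by simp
  have "x * w' - y * z' = r * s * (i * l - j * k)"
    by (simp add: x_def y_def z'_def w'_def algebra_simps)
  then have det: "x * w' - y * z' = r * s" using kl by simp
  have "(k, l) \<noteq> (0, 0)" using kl by auto
  from least[OF this] have le: "hex_norm (x, y) \<le> hex_norm (z', w')"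
    by (simp add: N_def x_def y_def z'_def w'_def)
  have "4 * (hex_norm (x, y) * hex_norm (z', w')) = \<beta> * \<beta> + 3 * ((x * w' - y * z') * (x * w' - y * z'))"
    by (simp add: hex_norm_def \<beta>_def algebra_simps)
  moreover have "hex_norm (x, y) * hex_norm (x, y) \<le> hex_norm (x, y) * hex_norm (z', w')"
    using le hex_norm_nonneg by (intro mult_left_mono) auto
  moreover have "\<beta> * \<beta> \<le> hex_norm (x, y) * hex_norm (x, y)"
    using bound abs_mult_self_eq[of \<beta>] mult_mono[OF bound bound] hex_norm_nonneg[of "(x, y)"] by simp
  ultimately have "hex_norm (x, y) * hex_norm (x, y) \<le> (r * s) * (r * s)" unfolding det by linarith
  then have "hex_norm (x, y) \<le> r * s"
    using assms by (metis abs_le_square_iff power2_eq_square abs_of_nonneg hex_norm_nonneg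
        mult_nonneg_nonneg order_trans zero_le_one)
  then show ?thesis using that[OF kl] by (simp add: x_def y_def)
qed

text \<open>For norms 4 and 7 only five colours are obtained here; whether four suffice depends on
  divisibility and is settled through \<open>short_parameters\<close>.\<close>

lemma colorable_large:
  assumes "r \<ge> 1" "s \<ge> 1" "r * s \<ge> 56"
    and loopless: "\<And>x y. in_lattice r s t x y \<Longrightarrow> hex_norm (x, y) \<noteq> 1"
  shows "(\<exists>x y. in_lattice r s t x y \<and> hex_norm (x, y) \<in> {4, 7} \<and> colorable 5 (T r s t)) \<or>
    colorable 4 (T r s t)"
proof -
  obtain i j k l where ijkl: "i * l - j * k = 1" and le: "hex_norm (r * i, t * i + s * j) \<le> r * s"
    using short_basis[OF assms(1,2)] .
  let ?x = "r * i" and ?y = "t * i + s * j" and ?z = "r * k" and ?w = "t * k + s * l"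
  have L: "in_lattice r s t ?x ?y" using assms(1) by (simp add: in_lattice_def)
  have "?x * ?w - ?y * ?z = r * s * (i * l - j * k)" by (simp add: algebra_simps)
  then have det: "\<bar>?x * ?w - ?y * ?z\<bar> = r * s" using ijkl assms by simp
  have col: "colorable (nat q) (T r s t)" if "q > 0" "good q (r * s) (?x, ?y) (?z, ?w)" for q
    using lattice_coloring_of_good[OF _ that(1) good_basis_change[OF that(2) ijkl]] assms
      colorable_of_lattice_coloring[OF assms(1,2)] by auto
  show ?thesis
  proof (cases "hex_norm (?x, ?y) \<in> {4, 7}")
    case True
    then show ?thesis using L col[of 5] good5[OF _ det] assms(3) by auto
  next
    case False
    then show ?thesis using col[of 4] good4[OF assms(3) det le] loopless[OF L] by auto
  qed
qed

section \<open>Short lattice vectors\<close>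

text \<open>One vector from each opposite pair of norm 4 (the first three) or 7 (the other
  six).\<close>

definition short_vectors :: "(int \<times> int) list" where
  "short_vectors = [(2,0), (0,2), (2,-2), (2,1), (1,2), (-1,3), (-2,3), (-3,2), (-3,1)]"

definition has_short :: "int \<Rightarrow> int \<Rightarrow> int \<Rightarrow> bool" where
  "has_short r s t \<longleftrightarrow> (\<exists>v \<in> set short_vectors. in_lattice r s t (fst v) (snd v))"

definition loopless :: "int \<Rightarrow> int \<Rightarrow> int \<Rightarrow> bool" where
  "loopless r s t \<longleftrightarrow> \<not> (in_lattice r s t 0 1 \<or> in_lattice r s t 1 0 \<or> in_lattice r s t 1 (- 1))"

lemma in_lattice_uminus:
  assumes "in_lattice r s t x y"
  shows "in_lattice r s t (- x) (- y)"
proof -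
  have "r dvd x" "s dvd y - t * (x div r)" using assms by (simp_all add: in_lattice_def)
  then have "- x div r = - (x div r)" by (simp add: dvd_neg_div)
  then have "- y - t * (- x div r) = - (y - t * (x div r))" by simp
  then show ?thesis using \<open>r dvd x\<close> \<open>s dvd y - t * (x div r)\<close> unfolding in_lattice_def by (metis dvd_minus_iff)
qed

lemma hex_norm_bound:
  assumes "hex_norm (x, y) \<le> 7"
  shows "x \<in> set [-3..3]" "y \<in> set [-3..3]"
proof -
  have *: "z \<in> set [-3..3]" if "hex_norm (z, w) \<le> 7" for z w
  proof -
    have "4 * hex_norm (z, w) = 3 * (z * z) + (z + 2 * w) * (z + 2 * w)"
      by (simp add: hex_norm_def algebra_simps)
    moreover have "(z + 2 * w) * (z + 2 * w) \<ge> 0" by simp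
    ultimately have "z * z < 4 * 4" using that by linarith
    then have "\<not> 4 \<le> \<bar>z\<bar>" using mult_mono[of 4 "\<bar>z\<bar>" 4 "\<bar>z\<bar>"] by (auto simp flip: abs_mult)
    then show ?thesis by auto
  qed
  show "x \<in> set [-3..3]" using * assms .
  have "hex_norm (y, x) \<le> 7" using assms by (simp add: hex_norm_def algebra_simps)
  then show "y \<in> set [-3..3]" using * by blast
qed

lemma short_vectors_complete:
  "\<forall>x \<in> set [-3..3]. \<forall>y \<in> set [-3..3].
     (x * x + x * y + y * y \<in> set [4, 7] \<longrightarrow>
       (x, y) \<in> set short_vectors \<or>
       (- x, - y) \<in> set short_vectors) \<and>
     (x * x + x * y + y * y = 1 \<longrightarrow>
       (x, y) \<in> set [(0,1), (1,0), (1,-1)] \<or> (- x, - y) \<in> set [(0,1), (1,0), (1,-1)])"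
  by code_simp

lemma has_short_of_hex_norm:
  assumes "in_lattice r s t x y" "hex_norm (x, y) \<in> {4, 7}"
  shows "has_short r s t"
proof -
  have b: "x \<in> set [-3..3]" "y \<in> set [-3..3]" using hex_norm_bound[of x y] assms(2) by auto
  have "x * x + x * y + y * y \<in> set [4, 7]" using assms(2) by (simp add: hex_norm_def)
  then show ?thesis
    using short_vectors_complete[rule_format, OF b] assms(1) in_lattice_uminus[OF assms(1)]
    unfolding has_short_def by (metis fst_conv snd_conv)
qed

lemma loopless_hex_norm:
  assumes "loopless r s t" "in_lattice r s t x y"
  shows "hex_norm (x, y) \<noteq> 1"
proof
  assume 1: "hex_norm (x, y) = 1"
  have b: "x \<in> set [-3..3]" "y \<in> set [-3..3]" using hex_norm_bound[of x y] 1 by auto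
  have "x * x + x * y + y * y = 1" using 1 by (simp add: hex_norm_def)
  then show False
    using short_vectors_complete[rule_format, OF b] assms in_lattice_uminus[OF assms(2)]
    unfolding loopless_def by auto
qed

text \<open>Turns a divisibility into linear alternatives that can be compared with the range of
  \<open>t\<close>.\<close>

lemma dvd_range:
  fixes s z :: int
  assumes "s dvd z"
  shows "z \<le> 0 \<or> z = s \<or> 2 * s \<le> z"
proof -
  have "s dvd z - s" using assms by simp
  then show ?thesis using zdvd_imp_le[of s "z - s"] zdvd_imp_le[OF assms] by linarith
qed

lemma loopless_cases:
  assumes "r \<ge> 1" "s \<ge> 1" "0 \<le> t" "t \<le> s - 1" "r = 1 \<longrightarrow> 2 * t \<le> s - 1"
  shows "loopless r s t \<longleftrightarrow> \<not> (s = 1 \<or> (r = 1 \<and> s = 2) \<or> (r = 1 \<and> t = 0))"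
proof -
  have 1: "in_lattice r s t 0 1 \<longleftrightarrow> s = 1" using assms(2) by (auto simp: in_lattice_def)
  have r1: "r dvd 1 \<longleftrightarrow> r = 1" using assms(1) by auto
  have 2: "in_lattice r s t 1 0 \<longleftrightarrow> r = 1 \<and> t = 0"
    using assms zdvd_imp_le[of s t] unfolding in_lattice_def r1 by (cases "t = 0") auto
  have "s dvd - 1 - t \<longleftrightarrow> s dvd 1 + t" using dvd_minus_iff[of s "1 + t"] by simp
  then have 3: "in_lattice r s t 1 (- 1) \<longleftrightarrow> r = 1 \<and> s = t + 1"
    using assms zdvd_imp_le[of s "1 + t"] unfolding in_lattice_def r1 by auto
  show ?thesis unfolding loopless_def 1 2 3 using assms by auto
qed

text \<open>Each of the nine vectors makes \<open>r\<close> a divisor of its first coordinate, hence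
  at most 3 unless that coordinate is 0, and gives one congruence modulo \<open>s\<close>. The range
  of \<open>t\<close> leaves a single multiple of \<open>s\<close> for each congruence.\<close>

lemma short_parameters:
  assumes rst: "r \<ge> 1" "s \<ge> 1" "0 \<le> t" "t \<le> s - 1" "r = 1 \<longrightarrow> 2 * t \<le> s - 1"
    and "loopless r s t" "has_short r s t"
  shows "s = 2 \<or> r = 1 \<and> (t = 2 \<or> s = 2 * t + 2 \<or> s = 2 * t + 3 \<or> s = 3 * t + 1 \<or> s = 3 * t + 2) \<or>
    r = 2 \<and> (t = 0 \<or> t = 1 \<or> s = t + 2 \<or> s = t + 3) \<or> r = 3 \<and> (s = t + 1 \<or> s = t + 2)"
proof -
  have nl: "s \<noteq> 1" "\<not> (r = 1 \<and> s = 2)" "\<not> (r = 1 \<and> t = 0)"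
    using iffD1[OF loopless_cases[OF rst] assms(6)] by (simp_all only: de_Morgan_disj simp_thms)
  have s2: "s \<ge> 2" using nl(1) rst(2) by linarith
  have t1: "r = 1 \<Longrightarrow> t \<ge> 1 \<and> s \<ge> 3" using nl(2,3) s2 rst(3) by linarith
  obtain x y where "(x, y) \<in> set short_vectors" and L: "in_lattice r s t x y"
    using assms(7) unfolding has_short_def by (metis prod.collapse)
  then have xy: "(x, y) \<in> set [(2,0), (0,2), (2,-2), (2,1), (1,2), (-1,3), (-2,3), (-3,2), (-3,1)]"
    by (simp only: short_vectors_def)
  have dv: "r dvd x" "s dvd y - t * (x div r)" using L by (simp_all add: in_lattice_def)
  show ?thesis
  proof (cases "s = 2")
    case False
    then have s3: "s \<ge> 3" using s2 by simp
    have r: "r = 1 \<or> r = 2 \<or> r = 3 \<or> x = 0"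
    proof (cases "x = 0")
      case False
      then have "r \<le> \<bar>x\<bar>" using dv(1) zdvd_imp_le[of r "\<bar>x\<bar>"] by simp
      moreover have "\<bar>x\<bar> \<le> 3" using xy by auto
      ultimately show ?thesis using rst(1) by linarith
    qed simp
    have dv': "s dvd t * (x div r) - y" using dv(2) by (simp add: dvd_diff_commute)
    note D = dvd_range[of s]
    from r consider (r0) "x = 0" | (r1) "r = 1" | (r2) "r = 2" | (r3) "r = 3" by blast
    then show ?thesis
    proof cases
      case r0
      then have "y = 2" using xy by auto
      then have "s dvd 2" using r0 dv(2) by simp
      then show ?thesis using D[of 2] s3 by linarith
    next
      case r1
      have b: "t \<ge> 1" "2 * t \<le> s - 1" using t1[OF r1] rst(5) r1 by blast+
      \<comment> \<open>Both signs of t - 2 are recorded because \<open>dvd_range\<close> says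
        nothing about negative values.\<close>
      have "s dvd 2 * t \<or> s dvd 2 \<or> s dvd 2 * t + 2 \<or> s dvd 2 * t - 1 \<or> s dvd t - 2 \<and> s dvd 2 - t \<or>
          s dvd t + 3 \<or> s dvd 2 * t + 3 \<or> s dvd 3 * t + 2 \<or> s dvd 3 * t + 1"
        using xy dv(2) dv' unfolding r1 div_by_1 list.set insert_iff empty_iff prod.inject
        by (elim disjE conjE; simp add: mult.commute add.commute)
      then show ?thesis
        using b s3 D[of "2 * t"] D[of 2] D[of "2 * t + 2"] D[of "2 * t - 1"] D[of "t - 2"] D[of "2 - t"]
          D[of "t + 3"] D[of "2 * t + 3"] D[of "3 * t + 2"] D[of "3 * t + 1"] r1
        by smt
    next
      case r2
      have "s dvd t \<or> s dvd 2 \<or> s dvd t + 2 \<or> s dvd t - 1 \<and> s dvd 1 - t \<or> s dvd t + 3"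
        using xy dv dv' unfolding r2 list.set insert_iff empty_iff prod.inject
        by (elim disjE conjE; simp add: add.commute)
      then show ?thesis
        using rst(3,4) s3 D[of t] D[of 2] D[of "t + 2"] D[of "t - 1"] D[of "1 - t"] D[of "t + 3"] r2
        by smt
    next
      case r3
      have "s dvd 2 \<or> s dvd t + 2 \<or> s dvd t + 1"
        using xy dv dv' unfolding r3 list.set insert_iff empty_iff prod.inject
        by (elim disjE conjE; simp add: add.commute)
      then show ?thesis using rst(3,4) s3 D[of 2] D[of "t + 2"] D[of "t + 1"] r3 by smt
    qed
  qed simp
qed

section \<open>Four-colourings in the presence of a short vector\<close>

lemma colorable4_even:
  assumes "r \<ge> 1" "s \<ge> 1" "even r" "even s"
  shows "colorable 4 (T r s t)"
proof (rule colorable_of_lattice_coloring[OF assms(1,2)])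
  \<comment> \<open>The two bits of the colour are the parities of x and of \<open>?h x y\<close>;
    subtracting \<open>t\<close> once per period makes \<open>?h\<close> invariant under
    \<open>(r, t)\<close> whatever the parity of \<open>t\<close>.\<close>
  let ?h = "\<lambda>x y. y - t * (x div r)"
  let ?c = "\<lambda>x y. (if even x then 0 else 2) + (if even (?h x y) then 0 else 1 :: nat)"
  have "(x + r) div r = x div r + 1" for x using assms(1) by simp
  then show "lattice_coloring 4 r s t ?c"
    unfolding lattice_coloring_def using assms(3,4) by (auto simp: algebra_simps)
qed

text \<open>With one row, y - t x identifies the quotient with the integers modulo s, and the
  differences are 1, t and t + 1 = s / 2. Parity separates the odd differences 1 and t; the half of
  the cycle separates antipodes.\<close>

lemma colorable4_antipodal:
  assumes "odd t" "t \<ge> 1"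
  shows "colorable 4 (T 1 (2 * t + 2) t)"
proof (rule colorable_of_lattice_coloring)
  let ?s = "2 * t + 2"
  let ?f = "\<lambda>m. (if even m then 0 else 2) + (if m mod ?s < t + 1 then 0 else 1 :: nat)"
  have ev: "even (t + 1)" using assms by simp
  have half: "((m + (t + 1)) mod ?s < t + 1) \<longleftrightarrow> \<not> (m mod ?s < t + 1)" for m
  proof -
    define a where "a = m mod ?s"
    have a: "0 \<le> a" "a < ?s" using assms by (simp_all add: a_def)
    have "(m + (t + 1)) mod ?s = (a + (t + 1)) mod ?s" by (simp add: a_def mod_simps)
    also have "\<dots> = (if a < t + 1 then a + (t + 1) else a - (t + 1))"
    proof (cases "a < t + 1")
      case True
      then show ?thesis using a by (simp add: mod_pos_pos_trivial)
    next
      case False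
      have "(a + (t + 1)) mod ?s = (a - (t + 1) + ?s) mod ?s" by (simp add: algebra_simps)
      also have "\<dots> = (a - (t + 1)) mod ?s" by (rule mod_add_self2)
      also have "\<dots> = a - (t + 1)" using False a by (intro mod_pos_pos_trivial) auto
      finally show ?thesis using False by simp
    qed
    finally show ?thesis using a by (simp add: a_def)
  qed
  have per: "?f (m + ?s) = ?f m" for m by simp
  have 1: "?f (m + 1) \<noteq> ?f m" for m by simp
  have 2: "?f (m + t) \<noteq> ?f m" for m using assms by simp
  have 3: "?f (m + (t + 1)) \<noteq> ?f m" for m using half[of m] assms by simp
  show "lattice_coloring 4 1 ?s t (\<lambda>x y. ?f (y - t * x))"
    unfolding lattice_coloring_def
  proof (intro allI conjI)
    fix x y
    show "?f (y - t * x) < 4" by simp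
    show "?f (y + ?s - t * x) = ?f (y - t * x)" using per[of "y - t * x"] by (simp add: algebra_simps)
    show "?f (y + t - t * (x + 1)) = ?f (y - t * x)" by (simp add: algebra_simps)
    show "?f (y - t * (x + 1)) \<noteq> ?f (y - t * x)"
      using 2[of "y - t * (x + 1)"] by (simp add: algebra_simps)
    show "?f (y + 1 - t * x) \<noteq> ?f (y - t * x)" using 1[of "y - t * x"] by (simp add: algebra_simps)
    show "?f (y - t * (x + 1)) \<noteq> ?f (y + 1 - t * x)"
      using 3[of "y - t * (x + 1)"] by (simp add: algebra_simps)
  qed
qed (use assms in auto)

text \<open>Characters with values in the quarters of the circle: every nonzero residue modulo 4 is
  spread.\<close>

lemma colorable4_mod4:
  assumes "r \<ge> 1" "s \<ge> 1" "4 dvd s * B" "4 dvd r * A + t * B" "\<not> 4 dvd A" "\<not> 4 dvd B" "\<not> 4 dvd A - B"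
  shows "colorable 4 (T r s t)"
proof -
  have "spread 4 4 z" if "\<not> 4 dvd z" for z
  proof -
    have "z mod 4 \<noteq> 0" "0 \<le> z mod 4" "z mod 4 < 4" using that by (auto simp: dvd_eq_mod_eq_0)
    then have "1 \<le> z mod 4" "z mod 4 \<le> 3" by linarith+
    then show ?thesis by (simp add: spread_def)
  qed
  then show ?thesis
    using colorable_of_lattice_coloring[OF assms(1,2) lattice_coloring_character[of 4 4 s B r A t]] assms
    by simp
qed

lemma five_chromatic_one_row:
  assumes "t = 2 \<or> s \<in> {2 * t + 2, 2 * t + 3, 3 * t + 1, 3 * t + 2}" "s \<ge> 9" "s \<noteq> 11" "\<not> 4 dvd s"
  shows "(1, s, t) \<in> five_chromatic_params"
  using assms(1)
proof
  assume "t = 2"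
  then have "(1 :: int, s, t) \<in> {(1, s, 2) | s. s \<ge> 9 \<and> s \<noteq> 11 \<and> \<not> 4 dvd s}"
    using assms(2-4) by simp
  then show ?thesis unfolding five_chromatic_params_def by (simp only: Un_iff simp_thms)
next
  assume "s \<in> {2 * t + 2, 2 * t + 3, 3 * t + 1, 3 * t + 2}"
  then have "(1 :: int, s, t) \<in> {(1, s, t) | s t. s \<in> {2*t + 2, 2*t + 3, 3*t + 1, 3*t + 2} \<and>
      s \<ge> 9 \<and> s \<noteq> 11 \<and> \<not> 4 dvd s}"
    using assms(2-4) by (simp only: mem_Collect_eq prod.inject simp_thms) blast
  then show ?thesis unfolding five_chromatic_params_def by (simp only: Un_iff simp_thms)
qed

lemma five_chromatic_two_rows:
  assumes "t \<in> {0, 1, s - 3, s - 2}" "odd s" "s \<ge> 5"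
  shows "(2, s, t) \<in> five_chromatic_params"
proof -
  have "(2 :: int, s, t) \<in> {(2, s, t) | s t. t \<in> {0, 1, s - 3, s - 2} \<and> odd s \<and> s \<ge> 5}"
    using assms by blast
  then show ?thesis
    unfolding five_chromatic_params_def by (simp only: Un_iff simp_thms)
qed

lemma five_chromatic_three_rows:
  assumes "t \<in> {s - 2, s - 1}" "s \<ge> 3" "\<not> 4 dvd s"
  shows "(3, s, t) \<in> five_chromatic_params"
proof -
  have "(3 :: int, s, t) \<in> {(3, s, t) | s t. t \<in> {s - 2, s - 1} \<and> s \<ge> 3 \<and> \<not> 4 dvd s}"
    using assms by blast
  then show ?thesis
    unfolding five_chromatic_params_def by (simp only: Un_iff simp_thms)
qed

lemma five_chromatic_two_columns:
  assumes "t \<in> {0, 1}" "odd r" "r \<ge> 5"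
  shows "(r, 2, t) \<in> five_chromatic_params"
proof -
  have "(r, 2 :: int, t) \<in> {(r, 2, t) | r t. t \<in> {0, 1} \<and> odd r \<and> r \<ge> 5}"
    using assms by blast
  then show ?thesis
    unfolding five_chromatic_params_def by (simp only: Un_iff simp_thms)
qed

lemma five_chromatic_K5:
  assumes "t \<in> {1, 2}"
  shows "(1, 5, t) \<in> five_chromatic_params"
proof -
  have "(1 :: int, 5 :: int, t) \<in> {(1 :: int, 5 :: int, 1 :: int), (1, 5, 2)}"
    using assms by blast
  then show ?thesis
    unfolding five_chromatic_params_def by (simp only: Un_iff simp_thms)
qed

text \<open>Off the list of exceptions, the facts \<open>c0\<close> to \<open>c3\<close> give
  exactly the divisibility that the lower bounds demand, and then a character modulo 4, the parity
  colouring or the antipodal colouring exists.\<close>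

lemma short_colorable4:
  assumes rst: "r \<ge> 1" "s \<ge> 1" "0 \<le> t" "t \<le> s - 1" "r = 1 \<longrightarrow> 2 * t \<le> s - 1"
    and "loopless r s t" "has_short r s t"
    and E: "(r, s, t) \<notin> {(1, 7, 2)} \<union> K6_params \<union> AH_params \<union> five_chromatic_params"
  shows "colorable 4 (T r s t)"
proof -
  have nl: "s \<noteq> 1" "\<not> (r = 1 \<and> s = 2)" "\<not> (r = 1 \<and> t = 0)"
    using iffD1[OF loopless_cases[OF rst] assms(6)] by (simp_all only: de_Morgan_disj simp_thms)
  have s2: "s \<ge> 2" using nl(1) rst(2) by linarith
  have t1: "r = 1 \<Longrightarrow> t \<ge> 1 \<and> s \<ge> 3" using nl(2,3) s2 rst(3) by linarith
  have E7: "(r, s, t) \<noteq> (1, 7, 2)" and E6: "(r, s, t) \<notin> K6_params" and EA: "(r, s, t) \<notin> AH_params"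
    and E5: "(r, s, t) \<notin> five_chromatic_params"
    using E by (simp_all only: Un_iff singleton_iff de_Morgan_disj simp_thms)
  have c1: "4 dvd s" if "r = 1" "t = 2 \<or> s = 2 * t + 2 \<or> s = 2 * t + 3 \<or> s = 3 * t + 1 \<or> s = 3 * t + 2"
  proof (rule ccontr)
    assume n4: "\<not> 4 dvd s"
    have b: "t \<ge> 1" "2 * t \<le> s - 1" using t1[OF that(1)] rst(5) that(1) by blast+
    have "t = 2 \<or> s \<in> {2 * t + 2, 2 * t + 3, 3 * t + 1, 3 * t + 2}" using that(2) by blast
    from five_chromatic_one_row[OF this _ _ n4] have "s \<ge> 9 \<Longrightarrow> s \<noteq> 11 \<Longrightarrow> False"
      using E5[unfolded that(1)] by (rule notE[rotated])
    then have "\<not> (s \<ge> 9 \<and> s \<noteq> 11)" by blast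
    moreover have "s \<noteq> 4" "s \<noteq> 8" using n4 by auto
    \<comment> \<open>Apart from 3, which no admissible \<open>t\<close> realises, these lengths
      carry K5, K6, K7 and the Albertson-Hutchinson graph.\<close>
    ultimately have s: "s = 3 \<or> s = 5 \<or> s = 6 \<or> s = 7 \<or> s = 11"
      using t1[OF that(1)] by arith
    from s that(2) b have "(s, t) \<in> {(5, 1), (5, 2), (6, 2), (7, 2), (11, 2), (11, 3), (11, 4)}"
      by (elim disjE) (simp_all, presburger+)
    then show False using that(1) E7 E6 EA E5 five_chromatic_K5 by (auto simp: K6_params_def AH_params_def)
  qed
  have c2: "even s" if "r = 2" "t = 0 \<or> t = 1 \<or> s = t + 2 \<or> s = t + 3"
  proof (rule ccontr)
    assume od: "odd s"
    then have "\<not> s \<ge> 5" using five_chromatic_two_rows[OF _ od] E5 that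
      by (metis add_diff_cancel_right' insert_iff)
    then have s: "s = 3" using s2 od by presburger
    then have "t = 0 \<or> t = 1" using that(2) rst(3) by auto
    then show False using s that(1) E6 by (auto simp: K6_params_def)
  qed
  have c3: "4 dvd s" if "r = 3" "s = t + 1 \<or> s = t + 2" "s \<noteq> 2"
  proof (rule ccontr)
    assume "\<not> 4 dvd s"
    moreover have "s \<ge> 3" using s2 that by simp
    ultimately show False using five_chromatic_three_rows[of t s] E5 that
      by (metis add_diff_cancel_right' insert_iff)
  qed
  have c0: "even r" if "s = 2"
  proof (rule ccontr)
    assume od: "odd r"
    have t: "t = 0 \<or> t = 1" using rst that by auto
    have "r \<noteq> 1" using t1 that by auto
    moreover have "r \<noteq> 3" using E6 t that unfolding K6_params_def by auto
    ultimately have "r \<ge> 5" using od rst(1) by presburger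
    then show False using five_chromatic_two_columns[OF _ od] E5 t that by blast
  qed
  \<comment> \<open>The two remaining arguments of \<open>M\<close> are B and A, in this order:
    \<open>M[of 1 2]\<close> is the character 2 x + y modulo 4.\<close>
  note M = colorable4_mod4[OF rst(1,2), of _ _ t]
  have P: "s = 2 \<or> s \<noteq> 2 \<and> (r = 1 \<and> (t = 2 \<or> s = 2 * t + 2 \<or> s = 2 * t + 3 \<or> s = 3 * t + 1 \<or> s = 3 * t + 2) \<or>
    r = 2 \<and> (t = 0 \<or> t = 1 \<or> s = t + 2 \<or> s = t + 3) \<or> r = 3 \<and> (s = t + 1 \<or> s = t + 2))"
    using short_parameters[OF rst(1-5) assms(6,7)] by blast
  from P consider "s = 2" | (r1) "r = 1" "t = 2 \<or> s = 2 * t + 2 \<or> s = 2 * t + 3 \<or> s = 3 * t + 1 \<or> s = 3 * t + 2"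
    | (r2) "r = 2" "t = 0 \<or> t = 1 \<or> s = t + 2 \<or> s = t + 3" | (r3) "s \<noteq> 2" "r = 3" "s = t + 1 \<or> s = t + 2"
    by blast
  then show ?thesis
  proof cases
    case 1
    then show ?thesis using colorable4_even[OF rst(1,2)] c0 by simp
  next
    case r1
    then have d: "4 dvd s" using c1 by blast
    from r1(2) consider "t = 2" | "s = 2 * t + 2" | "s = 2 * t + 3" | "s = 3 * t + 1" | "s = 3 * t + 2" by blast
    then show ?thesis
    proof cases
      case 1
      then show ?thesis using M[of 1 2] d r1(1) by simp
    next
      case 2
      then have "odd t" using d by presburger
      then show ?thesis using colorable4_antipodal[of t] 2 r1 t1 by simp
    next
      case 3
      then show ?thesis using d by presburger
    next
      case 4
      then have "4 dvd 3 + t" using d by presburger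
      then show ?thesis using M[of 1 3] d r1(1) by simp
    next
      case 5
      then have "4 dvd 2 + t" using d by presburger
      then show ?thesis using M[of 1 2] d r1(1) by simp
    qed
  next
    case r2
    then show ?thesis using colorable4_even[OF rst(1,2)] c2 by simp
  next
    case r3
    then have d: "4 dvd s" using c3 by blast
    from r3(3) show ?thesis
    proof
      assume "s = t + 1"
      then have "4 dvd 9 + t" using d by presburger
      then show ?thesis using M[of 1 3] d r3(2) by simp
    next
      assume "s = t + 2"
      then have "4 dvd 6 + t" using d by presburger
      then show ?thesis using M[of 1 2] d r3(2) by simp
    qed
  qed
qed

section \<open>Quotients of small index\<close>

text \<open>All characters of the quotient are covered: with n = r s, killing \<open>(0, s)\<close>
  means B = r k and killing \<open>(r, t)\<close> then means A = m s - t k. Negation preserves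
  \<open>spread\<close>, so k up to s / 2 suffices.\<close>

definition has_character :: "int \<Rightarrow> int \<Rightarrow> int \<Rightarrow> int \<Rightarrow> bool" where
  "has_character q r s t \<longleftrightarrow>
     (\<exists>k \<in> set [0..s div 2]. spread q (r * s) (r * k) \<and>
       (\<exists>m \<in> set [0..r - 1]. spread q (r * s) (m * s - t * k) \<and> spread q (r * s) (m * s - t * k - r * k)))"

definition sporadic :: "(int \<times> int \<times> int) list" where
  "sporadic = [(1,13,3), (1,17,3), (1,18,3), (1,25,3), (1,17,4), (1,17,6), (1,25,6), (1,33,6), (1,19,7),
     (1,25,7), (1,26,7), (1,25,9), (1,25,10), (1,26,10), (1,37,10), (1,33,14),
     (2,9,3), (2,13,3), (2,9,4), (2,13,8), (3,6,1), (3,6,2), (3,11,2), (3,11,6), (5,5,2), (5,5,3)]"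

text \<open>The fallback of \<open>small_ok\<close> when \<open>has_character 4\<close> fails. Entry
  j of row i is the colour of the vertex (i, j), both counted from 1.\<close>

definition coloring_table :: "((int \<times> int \<times> int) \<times> nat list list) list" where
  "coloring_table = [
     ((1,15,3), [[0,1,2,1,2,0,3,0,1,2,1,2,3,0,3]]),
     ((3,5,1), [[0,1,2,0,3], [2,0,1,2,1], [1,2,3,0,3]]),
     ((1,20,3), [[0,1,3,1,2,0,2,0,3,1,3,1,2,0,2,3,1,3,0,2]]),
     ((1,20,7), [[0,1,2,0,3,1,2,1,2,0,3,1,2,3,0,3,1,2,0,3]]),
     ((4,5,2), [[0,1,2,3,1], [2,0,1,2,3], [1,3,0,1,0], [0,2,3,2,3]]),
     ((4,5,4), [[0,1,2,0,2], [2,0,3,1,3], [3,1,0,2,0], [2,3,1,3,1]]),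
     ((1,22,3), [[0,1,2,1,2,0,3,0,1,2,1,2,0,3,0,1,2,1,2,3,0,3]]),
     ((1,22,6), [[0,1,2,0,1,0,1,2,0,1,2,3,2,0,1,2,3,0,1,3,2,3]]),
     ((2,11,4), [[0,1,2,0,2,0,3,1,2,0,2], [2,0,1,3,1,2,0,3,1,3,1]]),
     ((2,11,5), [[0,1,2,0,2,0,1,3,2,0,2], [2,0,1,3,1,3,2,0,1,3,1]]),
     ((5,5,0), [[0,1,2,0,1], [2,0,1,2,3], [1,2,0,1,0], [0,1,2,3,2], [2,3,0,1,3]]),
     ((1,27,3), [[0,1,2,1,2,0,3,0,1,2,1,2,3,0,3,0,1,2,1,3,0,3,2,1,2,0,3]]),
     ((1,27,6), [[0,1,2,0,1,0,1,2,0,1,2,3,2,3,1,2,3,0,1,0,2,3,0,1,3,2,3]]),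
     ((3,9,1), [[0,1,2,0,3,0,1,2,3], [2,0,1,2,1,2,3,0,1], [1,2,3,0,3,1,2,3,0]]),
     ((3,9,5), [[0,1,2,0,3,1,2,0,3], [2,0,1,2,0,3,1,2,1], [1,2,0,3,1,2,3,0,3]]),
     ((2,14,4), [[0,1,2,0,3,1,2,3,0,3,1,2,0,3], [2,0,3,1,2,3,0,1,2,0,3,1,2,1]]),
     ((2,14,8), [[0,1,2,0,1,0,1,3,0,1,0,2,3,1], [2,0,1,3,2,3,0,2,3,2,3,1,2,3]]),
     ((1,29,3), [[0,1,2,1,2,0,3,0,1,2,1,2,0,3,0,1,2,1,2,0,3,0,1,2,1,2,3,0,3]]),
     ((1,29,7), [[0,1,2,0,3,1,3,1,2,0,1,2,0,2,0,3,1,2,0,1,3,1,2,0,3,1,2,0,2]]),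
     ((1,29,10), [[0,1,2,0,3,0,1,2,0,3,1,2,0,1,2,1,2,0,1,2,0,3,1,2,3,0,3,1,2]]),
     ((1,30,6), [[0,1,2,0,1,3,1,2,0,1,2,0,2,0,3,2,0,3,1,3,2,1,3,1,2,0,1,3,0,2]]),
     ((1,30,12), [[0,1,2,0,3,0,1,2,0,3,1,2,1,2,0,1,2,1,2,0,3,1,2,3,0,3,1,2,0,3]]),
     ((6,5,1), [[0,1,2,0,1], [2,0,1,2,3], [1,2,0,1,0], [0,1,3,2,3], [3,0,1,0,2], [2,3,2,3,1]]),
     ((6,5,3), [[0,1,2,0,1], [2,0,1,2,3], [1,2,0,1,0], [0,1,3,2,3], [3,2,1,0,1], [0,3,2,3,2]]),
     ((1,34,3), [[0,1,2,1,2,0,3,0,1,2,1,2,0,3,0,1,2,1,2,3,0,3,0,1,2,1,3,0,3,2,1,2,0,3]]),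
     ((1,34,10), [[0,1,2,0,1,2,3,0,1,0,1,2,0,1,2,3,0,1,2,3,2,0,1,2,3,0,1,2,3,0,1,3,2,3]]),
     ((2,17,7), [[0,1,2,0,3,1,2,3,0,3,1,2,0,1,2,1,3], [2,0,1,2,0,3,0,1,2,0,3,1,2,3,0,2,1]]),
     ((2,17,8), [[0,1,2,0,1,0,1,3,0,1,3,2,0,1,0,3,2], [2,0,1,3,2,3,2,1,3,2,0,1,2,3,2,0,1]]),
     ((1,35,6), [[0,1,2,0,1,2,1,2,0,1,2,0,3,0,1,2,0,1,2,1,2,0,1,2,3,0,3,1,2,3,0,1,2,0,3]]),
     ((7,5,4), [[0,1,2,0,1], [2,0,1,2,3], [1,2,0,1,0], [0,1,2,3,2], [2,0,1,0,1], [1,2,3,2,0], [3,0,1,3,2]]),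
     ((1,38,6), [[0,1,2,0,1,2,1,2,0,1,2,0,3,0,1,2,3,1,2,1,2,3,1,0,3,0,3,1,0,3,2,1,2,0,3,2,0,3]]),
     ((1,38,10), [[0,1,2,0,1,2,0,3,1,2,1,2,0,1,2,0,3,1,2,3,0,3,1,2,0,3,1,2,3,0,1,2,0,3,1,2,0,3]]),
     ((2,19,4), [[0,1,2,0,2,0,3,1,2,0,2,3,0,2,0,1,2,0,2], [2,0,1,3,1,2,0,3,1,3,1,2,3,1,3,0,1,3,1]]),
     ((2,19,13), [[0,1,2,0,2,0,1,2,0,2,0,3,1,2,0,2,3,0,2], [2,0,1,3,1,2,0,3,1,3,1,2,3,1,3,0,1,3,1]]),
     ((1,41,3), [[0,1,2,1,2,0,3,0,1,2,1,2,0,3,0,1,2,1,2,0,3,0,1,2,1,2,3,0,3,0,1,2,1,3,0,3,2,1,2,0,3]]),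
     ((1,41,10), [[0,1,2,0,3,1,0,2,1,3,1,2,0,1,2,0,2,1,0,2,0,3,1,2,3,1,3,0,2,1,3,2,0,3,1,0,2,1,3,0,2]]),
     ((1,41,14), [[0,1,2,0,3,1,2,0,3,0,1,2,0,3,1,2,0,1,2,0,3,1,2,1,2,0,1,2,0,3,1,2,0,3,1,2,3,0,3,1,2]]),
     ((1,43,6), [[0,1,2,0,1,2,1,2,0,1,2,0,3,0,1,2,0,1,2,1,2,0,1,2,3,0,3,1,2,0,1,2,1,0,3,1,2,3,0,3,2,0,3]]),
     ((1,45,18), [[0,1,2,0,1,2,0,3,0,1,2,0,3,1,2,0,1,2,1,2,0,1,2,0,1,2,1,2,0,1,2,0,3,1,2,3,0,3,1,2,0,1,2,0,3]]),
     ((9,5,3), [[0,1,2,0,1], [2,0,1,2,3], [1,2,0,1,0], [0,1,2,3,2], [2,0,1,0,1], [1,2,3,2,0], [0,1,0,1,2], [2,3,2,0,1], [0,1,3,2,3]]),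
     ((1,49,18), [[0,1,2,0,1,2,1,0,2,1,3,0,3,1,2,3,0,2,1,2,0,1,2,0,3,2,1,3,0,2,1,2,0,1,2,3,0,3,1,3,0,1,2,0,3,0,2,1,3]])]"

text \<open>Among these only (1, 13, 3) is claimed to be 5-chromatic; it receives an explicit
  colouring in \<open>colorable5_13\<close>.\<close>

definition no_character5 :: "(int \<times> int \<times> int) list" where
  "no_character5 = [(2,2,0), (1,6,2), (2,3,0), (2,3,1), (3,2,0), (3,2,1), (1,7,2), (1,8,3), (4,2,1),
     (1,11,2), (1,11,3), (1,11,4), (2,6,0), (2,6,4), (6,2,0), (1,13,3), (1,16,7), (8,2,1)]"

text \<open>For a short vector or a sporadic triple the question of four colours is answered
  elsewhere, so only five colours are certified.\<close>

definition small_ok :: "int \<Rightarrow> int \<Rightarrow> int \<Rightarrow> bool" where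
  "small_ok r s t \<longleftrightarrow>
     \<not> loopless r s t \<or>
     (if has_short r s t \<or> (r, s, t) \<in> set sporadic
      then has_character 5 r s t \<or> (r, s, t) \<in> set no_character5
      else has_character 4 r s t \<or> (r, s, t) \<in> set (map fst coloring_table))"

definition table_proper :: "nat \<Rightarrow> (int \<times> int \<times> int) \<times> nat list list \<Rightarrow> bool" where
  "table_proper k = (\<lambda>((r, s, t), rows).
     (\<forall>v \<in> set (List.product [1..r] [1..s]). rows ! nat (fst v - 1) ! nat (snd v - 1) < k \<and>
       (\<forall>u \<in> set (T_nbrs r s t v).
         rows ! nat (fst v - 1) ! nat (snd v - 1) \<noteq> rows ! nat (fst u - 1) ! nat (snd u - 1))))"

lemma colorable_of_table:
  assumes "table_proper k ((r, s, t), rows)"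
  shows "colorable k (T r s t)"
  using assms unfolding colorable_T_iff table_proper_def case_prod_conv set_product set_upto
  by (intro exI[of _ "\<lambda>v. rows ! nat (fst v - 1) ! nat (snd v - 1)"]) blast

lemma coloring_table_proper: "\<forall>e \<in> set coloring_table. table_proper 4 e"
  by code_simp

lemma colorable5_13: "colorable 5 (T 1 13 3)"
proof (rule colorable_of_table)
  show "table_proper 5 ((1, 13, 3), [[0,1,2,1,2,0,3,0,1,4,2,4,3]])"
    by code_simp
qed

lemma colorable_of_character:
  assumes "r \<ge> 1" "s \<ge> 1" "q > 0" "has_character q r s t"
  shows "colorable (nat q) (T r s t)"
proof -
  obtain k m where "spread q (r * s) (r * k)" "spread q (r * s) (m * s - t * k)"
    "spread q (r * s) (m * s - t * k - r * k)"
    using assms(4) by (auto simp: has_character_def)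
  moreover have "r * s dvd s * (r * k)" "r * (m * s - t * k) + t * (r * k) = r * s * m"
    by (simp_all add: algebra_simps)
  moreover have "r * s > 0" using assms by simp
  ultimately show ?thesis
    using lattice_coloring_character[of "r * s" q s "r * k" r "m * s - t * k" t] assms(3)
      colorable_of_lattice_coloring[OF assms(1,2)] by (metis dvd_triv_left)
qed

lemma small_ok_one_row: "\<forall>s \<in> set [1..55]. \<forall>t \<in> set [0..(s - 1) div 2]. small_ok 1 s t"
  by code_simp

lemma small_ok_two_rows: "\<forall>s \<in> set [1..27]. \<forall>t \<in> set [0..s - 1]. small_ok 2 s t"
  by code_simp

lemma small_ok_more_rows: "\<forall>r \<in> set [3..55]. \<forall>s \<in> set [1..55 div r]. \<forall>t \<in> set [0..s - 1]. small_ok r s t"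
  by code_simp

section \<open>Lower bounds\<close>

lemma lattice_coloring_in_lattice:
  assumes "lattice_coloring k r s t c" "in_lattice r s t a b"
  shows "c (x + a) (y + b) = c x y"
proof -
  obtain j where j: "b - t * (a div r) = s * j" and "r dvd a"
    using assms(2) unfolding in_lattice_def by blast
  then have "a = r * (a div r)" "b = t * (a div r) + s * j" by (simp_all add: algebra_simps)
  then show ?thesis using lattice_coloring_periodic[OF assms(1), of x "a div r" y j]
    by (metis add.assoc)
qed

text \<open>If \<open>(1, 0)\<close> and \<open>(0, 1)\<close> are congruent to \<open>p g\<close> and \<open>q g\<close>, the quotient is the circulant
  graph on the multiples of \<open>g\<close> with differences \<open>p\<close>, \<open>q\<close> and \<open>p - q\<close>.\<close>

lemma circulant_of_lattice_coloring:
  fixes r s t gx gy p q :: int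
  assumes rs: "r \<ge> 1" and c: "lattice_coloring k r s t c"
    and p: "in_lattice r s t (1 - p * gx) (- p * gy)" and q: "in_lattice r s t (- q * gx) (1 - q * gy)"
  shows "\<exists>f :: int \<Rightarrow> nat. (\<forall>m. f m < k) \<and> (\<forall>m. f (m + r * s) = f m) \<and>
    (\<forall>m. \<forall>e \<in> {p, q, p - q}. f (m + e) \<noteq> f m)"
proof (intro exI conjI allI ballI)
  let ?f = "\<lambda>m. c (m * gx) (m * gy)"
  note C = lattice_coloringD[OF c]
  show "?f m < k" for m by (rule C(1))
  \<comment> \<open>The index of a sublattice annihilates the quotient.\<close>
  have "in_lattice r s t (r * s * gx) (r * s * gy)"
    using rs by (simp add: in_lattice_def mult.assoc)
  then show "?f (m + r * s) = ?f m" for m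
    using lattice_coloring_in_lattice[OF c, of "r * s * gx" "r * s * gy" "m * gx" "m * gy"]
    by (simp add: distrib_right)
  have fp: "?f (m + p) = c (m * gx + 1) (m * gy)" for m
    using lattice_coloring_in_lattice[OF c p, of "(m + p) * gx" "(m + p) * gy"] by (simp add: algebra_simps)
  have fq: "?f (m + q) = c (m * gx) (m * gy + 1)" for m
    using lattice_coloring_in_lattice[OF c q, of "(m + q) * gx" "(m + q) * gy"] by (simp add: algebra_simps)
  have "?f (m + (p - q)) \<noteq> ?f m" for m
  proof -
    have "?f (m + (p - q)) \<noteq> ?f (m - q + q)"
      using fp[of "m - q"] fq[of "m - q"] C(6)[of "(m - q) * gx" "(m - q) * gy"] by (simp add: algebra_simps)
    then show ?thesis by simp
  qed
  then show "?f (m + e) \<noteq> ?f m" if "e \<in> {p, q, p - q}" for m e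
    using that fp fq C(4)[of "m * gx" "m * gy"] C(5)[of "m * gx" "m * gy"] by auto
qed

lemma mem_of_distinct4:
  fixes a b c d x :: nat
  assumes "distinct [a, b, c, d]" "a < 4" "b < 4" "c < 4" "d < 4" "x < 4"
  shows "x \<in> {a, b, c, d}"
proof -
  have "{a, b, c, d} = {..<4}" using assms by (intro card_subset_eq) auto
  then show ?thesis using assms(6) by auto
qed

text \<open>Any four consecutive vertices form a K4 and use up all colours, so f has period 4. A
  nonzero remainder of n modulo 4 would be a period and an edge difference at once.\<close>

lemma cube_of_cycle_4_dvd:
  fixes f :: "int \<Rightarrow> nat"
  assumes "\<And>m. f m < 4" "\<And>m. f (m + n) = f m" "\<And>m e. e \<in> {1, 2, 3} \<Longrightarrow> f (m + e) \<noteq> f m"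
  shows "4 dvd n"
proof -
  have f4: "f (m + 4) = f m" for m
  proof -
    have e: "m + 1 + 1 = m + 2" "m + 1 + 2 = m + 3" "m + 1 + 3 = m + 4" "m + 2 + 1 = m + 3"
      "m + 2 + 2 = m + 4" "m + 3 + 1 = m + 4" by simp_all
    have "distinct [f m, f (m + 1), f (m + 2), f (m + 3)]"
      using assms(3)[of 1 m] assms(3)[of 2 m] assms(3)[of 3 m] assms(3)[of 1 "m + 1"]
        assms(3)[of 2 "m + 1"] assms(3)[of 1 "m + 2"]
      unfolding e by (simp add: eq_commute)
    from mem_of_distinct4[OF this assms(1,1,1,1,1), of "m + 4"] show ?thesis
      using assms(3)[of 3 "m + 1"] assms(3)[of 2 "m + 2"] assms(3)[of 1 "m + 3"] unfolding e by auto
  qed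
  have "f (n mod 4) = f 0"
    using int_translation_invariant[of f 4 "n mod 4" "n div 4"] f4 assms(2)[of 0] by simp
  then have "n mod 4 \<notin> {1, 2, 3}" using assms(3)[of "n mod 4" 0] by (simp only: add_0) blast
  moreover have "0 \<le> n mod 4" "n mod 4 < 4" by simp_all
  ultimately have "n mod 4 = 0" unfolding insert_iff empty_iff by linarith
  then show ?thesis by auto
qed

lemma colorable4_cube_imp_dvd:
  fixes r s t gx gy p q :: int
  assumes rs: "r \<ge> 1" "s \<ge> 1" and "colorable 4 (T r s t)"
    and "in_lattice r s t (1 - p * gx) (- p * gy)" "in_lattice r s t (- q * gx) (1 - q * gy)"
    and pq: "{1, 2, 3} \<subseteq> {\<bar>p\<bar>, \<bar>q\<bar>, \<bar>p - q\<bar>}"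
  shows "4 dvd r * s"
proof -
  obtain c where c: "lattice_coloring 4 r s t c"
    using lattice_coloring_of_colorable[OF rs assms(3)] .
  obtain f :: "int \<Rightarrow> nat" where f': "\<forall>m. f m < 4" "\<forall>m. f (m + r * s) = f m"
    "\<forall>m. \<forall>e \<in> {p, q, p - q}. f (m + e) \<noteq> f m"
    using circulant_of_lattice_coloring[OF rs(1) c assms(4,5)] by blast
  have f: "\<And>m. f m < 4" "\<And>m. f (m + r * s) = f m"
    "\<And>m e. e \<in> {p, q, p - q} \<Longrightarrow> f (m + e) \<noteq> f m"
    using f' by blast+
  have abs: "f (m + \<bar>e\<bar>) \<noteq> f m" if "e \<in> {p, q, p - q}" for m e
  proof (cases "e \<ge> 0")
    case True
    then show ?thesis using f(3)[OF that, of m] by simp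
  next
    case False
    then show ?thesis using f(3)[OF that, of "m - e"] by simp
  qed
  have "f (m + e) \<noteq> f m" if "e \<in> {1, 2, 3}" for m e
  proof -
    have "e \<in> abs ` {p, q, p - q}" using pq that by auto
    then show ?thesis using abs by blast
  qed
  then show ?thesis using cube_of_cycle_4_dvd[of f "r * s"] f by blast
qed

text \<open>Consecutive pairs exhaust the four colours, so the pair of colours repeats with period
  2. At an odd R it is disjoint from the pair at 0, which \<open>R\<close> forbids.\<close>

lemma alternating_pairs_even:
  fixes f g :: "int \<Rightarrow> nat"
  assumes lt: "\<And>h. f h < 4" "\<And>h. g h < 4" and ne: "\<And>h. f h \<noteq> g h"
    and "\<And>h. f (h + 1) \<noteq> f h" "\<And>h. f (h + 1) \<noteq> g h" "\<And>h. g (h + 1) \<noteq> f h" "\<And>h. g (h + 1) \<noteq> g h"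
    and R: "f R = f 0 \<or> f R = g 0"
  shows "even R"
proof (rule ccontr)
  assume "odd R"
  then obtain k where k: "R = 1 + 2 * k" by (metis add.commute oddE)
  have two: "{f (h + 2), g (h + 2)} = {f h, g h}" for h
  proof -
    have e: "h + 1 + 1 = h + 2" by simp
    have i: "x = f h \<or> x = g h" if "x < 4" "x \<noteq> f (h + 1)" "x \<noteq> g (h + 1)" for x
    proof -
      have "distinct [f h, g h, f (h + 1), g (h + 1)]"
        using ne[of h] ne[of "h + 1"] assms(4-7)[of h] by (simp add: eq_commute)
      from mem_of_distinct4[OF this lt lt that(1)] show ?thesis using that by auto
    qed
    show ?thesis
      using i[OF lt(1)[of "h + 2"]] i[OF lt(2)[of "h + 2"]] ne[of "h + 2"] assms(4-7)[of "h + 1"]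
      unfolding e by auto
  qed
  have "{f (1 + 2 * k), g (1 + 2 * k)} = {f 1, g 1}"
    using int_translation_invariant[of "\<lambda>h. {f h, g h}" 2 1 k] two by blast
  then have "f R = f 1 \<or> f R = g 1" using k by auto
  then show False using R assms(4-7)[of 0] by auto
qed

text \<open>A translation \<open>e\<close> of order two with \<open>e = (1, 0)\<close>, \<open>(0, 1)\<close> or \<open>(1, -1)\<close> splits the vertices
  into edges \<open>{h d, h d + e}\<close>, and consecutive edges span a \<open>K\<^sub>4\<close>.\<close>

lemma colorable4_involution_even:
  assumes rs: "r \<ge> 1" "s \<ge> 1" and "colorable 4 (T r s t)"
    and e: "(ex, ey, dx, dy) \<in> {(0, 1, 1, 0), (1, 0, 0, 1), (1, -1, 0, 1)}"
    and L: "in_lattice r s t (2 * ex) (2 * ey)"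
    and R: "in_lattice r s t (R * dx) (R * dy) \<or> in_lattice r s t (R * dx - ex) (R * dy - ey)"
  shows "even R"
proof -
  obtain c where c: "lattice_coloring 4 r s t c"
    using lattice_coloring_of_colorable[OF rs assms(3)] .
  note C = lattice_coloringD[OF c]
  have two: "c (x + 2 * ex) (y + 2 * ey) = c x y" for x y
    using lattice_coloring_in_lattice[OF c L] .
  let ?f = "\<lambda>h. c (h * dx) (h * dy)" and ?g = "\<lambda>h. c (h * dx + ex) (h * dy + ey)"
  have n: "c x y \<noteq> c (x + 1) y" "c x y \<noteq> c (x - 1) y" "c x y \<noteq> c x (y + 1)" "c x y \<noteq> c x (y - 1)"
    "c x y \<noteq> c (x + 1) (y - 1)" "c x y \<noteq> c (x - 1) (y + 1)" for x y
    using C(4)[of x y] C(4)[of "x - 1" y] C(5)[of x y] C(5)[of x "y - 1"] C(6)[of x "y - 1"]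
      C(6)[of "x - 1" y] by (simp_all add: eq_commute)
  \<comment> \<open>As 2 e is a period, d + e and d - e are congruent. One of them is a lattice
    step, as d and e are, so two consecutive edges span a K4.\<close>
  have d: "c (x + dx) (y + dy) \<noteq> c x y" "c (x + ex) (y + ey) \<noteq> c x y"
    "c (x + dx) (y + dy) \<noteq> c (x + ex) (y + ey)" "c (x + dx + ex) (y + dy + ey) \<noteq> c x y" for x y
  proof -
    have "c (x + 1) (y - 1) = c (x - 1) (y + 1)" if "ex = 1" "ey = - 1"
      using two[of "x - 1" "y + 1"] that by (simp add: add.commute)
    moreover have "c x (y + 1) = c x (y - 1)" if "ex = 0" "ey = 1"
      using two[of x "y - 1"] that by (simp add: add.commute)
    moreover have "c (x + 1) y = c (x - 1) y" if "ex = 1" "ey = 0"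
      using two[of "x - 1" y] that by (simp add: add.commute)
    moreover have "c (x + 1) (y + 1) = c (x + 1) (y - 1)" if "ex = 0" "ey = 1"
      using two[of "x + 1" "y - 1"] that by (simp add: add.commute)
    moreover have "c (x + 1) (y + 1) = c (x - 1) (y + 1)" if "ex = 1" "ey = 0"
      using two[of "x - 1" "y + 1"] that by (simp add: add.commute)
    moreover have "c x (y + 1) \<noteq> c (x + 1) (y - 1)" if "ex = 1" "ey = - 1"
      using two[of "x - 1" "y + 1"] n(2)[of x "y + 1"] that by (simp add: add.commute)
    ultimately show "c (x + dx) (y + dy) \<noteq> c x y" "c (x + ex) (y + ey) \<noteq> c x y"
      "c (x + dx) (y + dy) \<noteq> c (x + ex) (y + ey)" "c (x + dx + ex) (y + dy + ey) \<noteq> c x y"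
      using e n[of x y] n[of x "y + 1"] n[of "x + 1" y] C(6)[of x y] by auto
  qed
  show ?thesis
  proof (rule alternating_pairs_even[of ?f ?g])
    fix h
    show "?f h < 4" "?g h < 4" by (rule C(1))+
    have "?f (h + 1) = c (h * dx + dx) (h * dy + dy)"
      "?g (h + 1) = c (h * dx + dx + ex) (h * dy + dy + ey)" by (simp_all add: algebra_simps)
    then show "?f (h + 1) \<noteq> ?f h" "?f (h + 1) \<noteq> ?g h" "?g (h + 1) \<noteq> ?f h" "?g (h + 1) \<noteq> ?g h"
      using d(1)[of "h * dx" "h * dy"] d(1)[of "h * dx + ex" "h * dy + ey"] d(3,4)[of "h * dx" "h * dy"]
      by (simp_all add: algebra_simps)
    show "?f h \<noteq> ?g h" using d(2)[of "h * dx" "h * dy"] by simp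
  next
    show "?f R = ?f 0 \<or> ?f R = ?g 0"
      using R lattice_coloring_in_lattice[OF c, of "R * dx" "R * dy" 0 0]
        lattice_coloring_in_lattice[OF c, of "R * dx - ex" "R * dy - ey" ex ey] by auto
  qed
qed

section \<open>Independent sets in circulant graphs\<close>

function indep_le :: "int list \<Rightarrow> int list \<Rightarrow> nat \<Rightarrow> bool" where
  "indep_le D [] k = True"
| "indep_le D (x # xs) k = (length (x # xs) \<le> k \<or>
     (case k of 0 \<Rightarrow> False
      | Suc k' \<Rightarrow> indep_le D (filter (\<lambda>y. \<not> List.member D (y - x)) xs) k' \<and> indep_le D xs k))"
  by pat_completeness auto
termination by (relation "measure (\<lambda>(D, xs, k). length xs)") (auto simp: le_imp_less_Suc)

text \<open>Branching on the first vertex: a set that contains it loses its neighbours and one unit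
  of the bound, any other set lives in the tail. The list ascends, so only positive differences are
  tested.\<close>

lemma card_le_of_indep_le:
  assumes "indep_le D xs k" "sorted_wrt (<) xs" "A \<subseteq> set xs"
    and "\<And>i j. i \<in> A \<Longrightarrow> j \<in> A \<Longrightarrow> i < j \<Longrightarrow> j - i \<notin> set D"
  shows "card A \<le> k"
  using assms
proof (induction D xs k arbitrary: A rule: indep_le.induct)
  case (2 D x xs k)
  have fin: "finite A" using 2(5) finite_subset by blast
  show ?case
  proof (cases "length (x # xs) \<le> k")
    case True
    have "card A \<le> card (set (x # xs))" using 2(5) by (intro card_mono) auto
    also have "\<dots> \<le> length (x # xs)" by (rule card_length)
    finally show ?thesis using True by linarith
  next
    case False
    then obtain k' where k: "k = Suc k'" and i1: "indep_le D (filter (\<lambda>y. \<not> List.member D (y - x)) xs) k'"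
      and i2: "indep_le D xs k"
      using 2(3) by (auto split: nat.splits)
    show ?thesis
    proof (cases "x \<in> A")
      case True
      have "card (A - {x}) \<le> k'"
      proof (rule 2(1)[OF k i1])
        show "sorted_wrt (<) (filter (\<lambda>y. \<not> List.member D (y - x)) xs)"
          using 2(4) by (simp add: sorted_wrt_filter)
        show "A - {x} \<subseteq> set (filter (\<lambda>y. \<not> List.member D (y - x)) xs)"
          using 2(4,5) 2(6)[OF True] by auto
        show "\<And>i j. i \<in> A - {x} \<Longrightarrow> j \<in> A - {x} \<Longrightarrow> i < j \<Longrightarrow> j - i \<notin> set D" using 2(6) by auto
      qed
      then show ?thesis using True fin k by (simp add: card_Diff_singleton)
    next
      case nA: False
      show ?thesis
        by (rule 2(2)[OF k i2]) (use 2(4,5,6) nA in auto)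
    qed
  qed
qed simp

text \<open>\<open>D\<close> is closed under negation modulo n, so that differences of
  representatives in 0..n - 1 need no reduction.\<close>

definition indep_table :: "(int \<times> int list \<times> nat) list" where
  "indep_table = [
     (5, [1,2,3,4], 1),
     (6, [1,2,3,4,5], 1),
     (7, [1,2,3,4,5,6], 1),
     (11, [1,2,3,8,9,10], 2),
     (13, [1,3,4,9,10,12], 3),
     (17, [1,3,4,13,14,16], 4),
     (18, [1,3,4,14,15,17], 4),
     (19, [2,3,5,14,16,17], 4),
     (25, [1,3,4,21,22,24], 6),
     (25, [2,3,5,20,22,23], 6),
     (26, [2,3,5,21,23,24], 6),
     (33, [2,3,5,28,30,31], 8),
     (37, [3,4,7,30,33,34], 9)]"

text \<open>By rotation an independent set may be assumed to contain 0; its other members then avoid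
  \<open>D\<close>, which leaves a - 1 of them.\<close>

definition indep_bound :: "int \<times> int list \<times> nat \<Rightarrow> bool" where
  "indep_bound = (\<lambda>(n, D, a). a > 0 \<and> indep_le D (filter (\<lambda>y. \<not> List.member D y) [1..n - 1]) (a - 1))"

lemma indep_table_bound: "\<forall>e \<in> set indep_table. indep_bound e"
  by code_simp

text \<open>A colour class is independent; translating it by one of its members puts 0 into it, so
  it has at most a elements, and k classes cover all n vertices.\<close>

lemma circulant_color_bound:
  fixes f :: "int \<Rightarrow> nat" and n :: int
  assumes n: "n > 0" and f: "\<And>m. f m < k" "\<And>m. f (m + n) = f m"
    and D: "\<And>m d. d \<in> set D \<Longrightarrow> f (m + d) \<noteq> f m" and b: "indep_bound (n, D, a)"
  shows "n \<le> int (k * a)"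
proof -
  have cls: "card {m \<in> {0..<n}. f m = x} \<le> a" for x
  proof (cases "{m \<in> {0..<n}. f m = x} = {}")
    case False
    then obtain m0 where m0: "f m0 = x" by auto
    let ?S = "{j \<in> {0..<n}. f (m0 + j) = x}"
    have per: "f (m mod n) = f m" for m
      using int_translation_invariant[of f n "m mod n" "m div n"] f(2) by simp
    have "card {m \<in> {0..<n}. f m = x} \<le> card ?S"
    proof (rule card_inj_on_le[of "\<lambda>m. (m - m0) mod n"])
      show "inj_on (\<lambda>m. (m - m0) mod n) {m \<in> {0..<n}. f m = x}"
      proof (rule inj_onI)
        fix a b assume ab: "a \<in> {m \<in> {0..<n}. f m = x}" "b \<in> {m \<in> {0..<n}. f m = x}"
          "(a - m0) mod n = (b - m0) mod n"
        then have "(a - m0 + m0) mod n = (b - m0 + m0) mod n" by (metis mod_add_left_eq)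
        then show "a = b" using ab by (simp add: mod_pos_pos_trivial)
      qed
      show "(\<lambda>m. (m - m0) mod n) ` {m \<in> {0..<n}. f m = x} \<subseteq> ?S"
      proof
        fix y assume "y \<in> (\<lambda>m. (m - m0) mod n) ` {m \<in> {0..<n}. f m = x}"
        then obtain m where m: "y = (m - m0) mod n" "f m = x" by auto
        have "f (m0 + y) = f ((m0 + y) mod n)" by (simp add: per)
        also have "(m0 + y) mod n = m mod n" by (simp add: m(1) mod_simps)
        finally show "y \<in> ?S" using m n by (simp add: per)
      qed
      show "finite ?S" by (rule finite_subset[of _ "{0..<n}"]) auto
    qed
    also have "card ?S \<le> a"
    proof -
      have "0 \<in> ?S" using m0 n by simp
      have "card (?S - {0}) \<le> a - 1"
      proof (rule card_le_of_indep_le)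
        show "indep_le D (filter (\<lambda>y. \<not> List.member D y) [1..n - 1]) (a - 1)"
          using b by (simp add: indep_bound_def)
        show "sorted_wrt (<) (filter (\<lambda>y. \<not> List.member D y) [1..n - 1])"
          by (simp add: sorted_wrt_filter)
        show "?S - {0} \<subseteq> set (filter (\<lambda>y. \<not> List.member D y) [1..n - 1])"
          using D[of _ m0] m0 by auto
        show "j - i \<notin> set D" if "i \<in> ?S - {0}" "j \<in> ?S - {0}" "i < j" for i j
          using D[of "j - i" "m0 + i"] that by auto
      qed
      moreover have "a > 0" using b by (simp add: indep_bound_def)
      moreover have "finite ?S" by (rule finite_subset[of _ "{0..<n}"]) auto
      then have "card ?S = Suc (card (?S - {0}))" using \<open>0 \<in> ?S\<close> by (simp only: card_Suc_Diff1)
      ultimately show ?thesis by linarith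
    qed
    finally show ?thesis .
  next
    case True
    show ?thesis unfolding True by simp
  qed
  define S where "S x = {m \<in> {0..<n}. f m = x}" for x
  have U: "{0..<n} = (\<Union>x<k. S x)" using f(1) by (auto simp: S_def)
  have "card {0..<n} = card (\<Union>x<k. S x)" by (subst U) (rule refl)
  also have "\<dots> \<le> (\<Sum>x<k. card (S x))" by (rule card_UN_le) simp
  also have "\<dots> \<le> (\<Sum>x<k. a)" using cls by (intro sum_mono) (simp add: S_def)
  finally have "nat n \<le> k * a" by simp
  then show ?thesis by (simp only: nat_le_iff)
qed

text \<open>Rows \<open>(k, (r, s, t), g, (p, q), n, D, a)\<close>: the quotient is the circulant on the multiples of
  \<open>g\<close> with differences \<open>D\<close>, whose independent sets have at most \<open>a\<close> elements, and \<open>k a < n\<close>.\<close>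

definition noncolorable_table ::
    "(nat \<times> (int \<times> int \<times> int) \<times> (int \<times> int) \<times> (int \<times> int) \<times> int \<times> int list \<times> nat) list" where
  "noncolorable_table = [
     (4, (1,13,3), (-1,1), (-4,-3), 13, [1,3,4,9,10,12], 3),
     (4, (1,17,3), (0,1), (-3,1), 17, [1,3,4,13,14,16], 4),
     (4, (1,17,4), (-1,0), (-1,-4), 17, [1,3,4,13,14,16], 4),
     (4, (1,17,6), (-1,0), (-1,3), 17, [1,3,4,13,14,16], 4),
     (4, (1,18,3), (0,-1), (3,-1), 18, [1,3,4,14,15,17], 4),
     (4, (1,19,7), (-1,2), (-5,-2), 19, [2,3,5,14,16,17], 4),
     (4, (1,25,3), (0,1), (-3,1), 25, [1,3,4,21,22,24], 6),
     (4, (1,25,6), (1,0), (1,4), 25, [1,3,4,21,22,24], 6),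
     (4, (1,25,7), (1,-1), (4,3), 25, [1,3,4,21,22,24], 6),
     (4, (1,25,9), (1,1), (-2,3), 25, [2,3,5,20,22,23], 6),
     (4, (1,25,10), (-1,2), (-5,-2), 25, [2,3,5,20,22,23], 6),
     (4, (1,26,7), (-1,2), (5,3), 26, [2,3,5,21,23,24], 6),
     (4, (1,26,10), (2,-1), (-2,-5), 26, [2,3,5,21,23,24], 6),
     (4, (1,33,6), (2,-1), (3,5), 33, [2,3,5,28,30,31], 8),
     (4, (1,33,14), (1,-2), (5,2), 33, [2,3,5,28,30,31], 8),
     (4, (1,37,10), (1,1), (-3,4), 37, [3,4,7,30,33,34], 9),
     (4, (2,9,3), (-1,1), (3,4), 18, [1,3,4,14,15,17], 4),
     (4, (2,9,4), (1,0), (1,4), 18, [1,3,4,14,15,17], 4),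
     (4, (2,13,3), (1,1), (3,-2), 26, [2,3,5,21,23,24], 6),
     (4, (2,13,8), (1,-2), (5,2), 26, [2,3,5,21,23,24], 6),
     (4, (3,6,1), (1,0), (1,-3), 18, [1,3,4,14,15,17], 4),
     (4, (3,6,2), (1,-1), (4,3), 18, [1,3,4,14,15,17], 4),
     (4, (3,11,2), (1,1), (-2,3), 33, [2,3,5,28,30,31], 8),
     (4, (3,11,6), (1,-2), (-5,-3), 33, [2,3,5,28,30,31], 8),
     (4, (5,5,2), (-2,1), (-3,-5), 25, [2,3,5,20,22,23], 6),
     (4, (5,5,3), (-2,1), (2,5), 25, [2,3,5,20,22,23], 6),
     (4, (1,5,1), (-1,0), (-1,1), 5, [1,2,3,4], 1),
     (4, (1,5,2), (1,0), (1,2), 5, [1,2,3,4], 1),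
     (5, (1,6,2), (0,-1), (2,-1), 6, [1,2,3,4,5], 1),
     (5, (2,3,0), (-1,-1), (3,2), 6, [1,2,3,4,5], 1),
     (5, (2,3,1), (1,0), (1,-2), 6, [1,2,3,4,5], 1),
     (5, (3,2,0), (-1,-1), (2,3), 6, [1,2,3,4,5], 1),
     (5, (3,2,1), (-1,0), (-1,3), 6, [1,2,3,4,5], 1),
     (5, (1,11,2), (0,-1), (2,-1), 11, [1,2,3,8,9,10], 2),
     (5, (1,11,3), (-1,1), (2,3), 11, [1,2,3,8,9,10], 2),
     (5, (1,11,4), (-1,1), (-3,-2), 11, [1,2,3,8,9,10], 2),
     (6, (1,7,2), (-1,0), (-1,-3), 7, [1,2,3,4,5,6], 1)]"

definition noncolorable_check ::
    "nat \<times> (int \<times> int \<times> int) \<times> (int \<times> int) \<times> (int \<times> int) \<times> int \<times> int list \<times> nat \<Rightarrow> bool" where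
  "noncolorable_check = (\<lambda>(k, (r, s, t), (gx, gy), (p, q), n, D, a).
     r \<ge> 1 \<and> s \<ge> 1 \<and> n = r * s \<and> int (k * a) < n \<and> (n, D, a) \<in> set indep_table \<and>
     in_lattice r s t (1 - p * gx) (- p * gy) \<and> in_lattice r s t (- q * gx) (1 - q * gy) \<and>
     (\<forall>d \<in> set D. \<exists>e \<in> set [p, q, p - q]. n dvd d - e \<or> n dvd d + e))"

lemma noncolorable_table_check: "\<forall>e \<in> set noncolorable_table. noncolorable_check e"
  by code_simp

lemma not_colorable_of_table:
  assumes "(k, (r, s, t), g, pq, n, D, a) \<in> set noncolorable_table"
  shows "\<not> colorable k (T r s t)"
proof
  assume col: "colorable k (T r s t)"
  obtain gx gy p q where g: "g = (gx, gy)" "pq = (p, q)" by (cases g, cases pq)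
  have "noncolorable_check (k, (r, s, t), g, pq, n, D, a)"
    using assms noncolorable_table_check by blast
  note chk = this[unfolded noncolorable_check_def g case_prod_conv]
  have rs: "r \<ge> 1" "s \<ge> 1" and n: "n = r * s" "int (k * a) < n" and ind: "(n, D, a) \<in> set indep_table"
    and L: "in_lattice r s t (1 - p * gx) (- p * gy)" "in_lattice r s t (- q * gx) (1 - q * gy)"
    using chk by blast+
  have D: "\<exists>e \<in> {p, q, p - q}. n dvd d - e \<or> n dvd d + e" if "d \<in> set D" for d
    using chk that unfolding list.set by blast
  obtain c where c: "lattice_coloring k r s t c" using lattice_coloring_of_colorable[OF rs col] .
  obtain f :: "int \<Rightarrow> nat" where f': "\<forall>m. f m < k" "\<forall>m. f (m + r * s) = f m"
    "\<forall>m. \<forall>e \<in> {p, q, p - q}. f (m + e) \<noteq> f m"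
    using circulant_of_lattice_coloring[OF rs(1) c L] by blast
  have f: "\<And>m. f m < k" "\<And>m. f (m + r * s) = f m"
    "\<And>m e. e \<in> {p, q, p - q} \<Longrightarrow> f (m + e) \<noteq> f m"
    using f' by blast+
  have per: "f (m + z) = f m" if "n dvd z" for m z
  proof -
    obtain w where "z = n * w" using \<open>n dvd z\<close> by (rule dvdE)
    then show ?thesis using int_translation_invariant[of f n m w] f(2) by (simp add: n(1))
  qed
  have "f (m + d) \<noteq> f m" if "d \<in> set D" for m d
  proof -
    obtain e where e: "e \<in> {p, q, p - q}" "n dvd d - e \<or> n dvd d + e" using D[OF \<open>d \<in> set D\<close>] by blast
    from e(2) show ?thesis
    proof
      assume "n dvd d - e"
      from per[OF this, of "m + e"] have "f (m + d) = f (m + e)" by simp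
      then show ?thesis using f(3)[OF e(1), of m] by simp
    next
      assume "n dvd d + e"
      from per[OF this, of m] have "f (m + d + e) = f m" by (simp add: add.assoc)
      then show ?thesis using f(3)[OF e(1), of "m + d"] by simp
    qed
  qed
  moreover have "indep_bound (n, D, a)" using ind indep_table_bound by blast
  moreover have "n > 0" using rs n(1) by simp
  ultimately have "n \<le> int (k * a)"
    using circulant_color_bound[of n f k D a] f(1) f(2)[folded n(1)] by blast
  then show False using n(2) by simp
qed

section \<open>The classification\<close>

lemma colorable_mono:
  assumes "colorable k G" "k \<le> l"
  shows "colorable l G"
  using assms unfolding colorable_def by (meson order_less_le_trans)

lemma chromatic_iff:
  assumes "k > 0"
  shows "chromatic k G \<longleftrightarrow> colorable k G \<and> \<not> colorable (k - 1) G"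
proof -
  have "(\<forall>l < k. \<not> colorable l G) \<longleftrightarrow> \<not> colorable (k - 1) G"
    using colorable_mono[of _ G "k - 1"] assms by (metis Suc_diff_1 diff_less less_Suc_eq_le less_one)
  then show ?thesis unfolding chromatic_def by simp
qed

lemma colorable_no_loop: "colorable k G \<Longrightarrow> \<not> has_loop G"
  unfolding colorable_def has_loop_def by metis

lemma T_has_loop:
  assumes "v \<in> {1..r} \<times> {1..s}" "v \<in> set (T_nbrs r s t v)"
  shows "has_loop (T r s t)"
proof -
  have "(v, v) \<in> arcs_ends (T r s t)" unfolding T_arcs_ends using assms by simp
  then show ?thesis unfolding has_loop_def by (auto simp: arcs_ends_conv)
qed

lemma five_cases:
  assumes "(r, s, t) \<in> five_chromatic_params"
  shows "(r = 1 \<and> s = 5 \<and> (t = 1 \<or> t = 2)) \<or>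
    (r = 1 \<and> (t = 2 \<or> s = 2 * t + 2 \<or> s = 2 * t + 3 \<or> s = 3 * t + 1 \<or> s = 3 * t + 2) \<and>
      s \<ge> 9 \<and> s \<noteq> 11 \<and> \<not> 4 dvd s) \<or>
    (r = 2 \<and> (t = 0 \<or> t = 1 \<or> t = s - 3 \<or> t = s - 2) \<and> odd s \<and> s \<ge> 5) \<or>
    (r = 3 \<and> (t = s - 2 \<or> t = s - 1) \<and> s \<ge> 3 \<and> \<not> 4 dvd s) \<or>
    (s = 2 \<and> (t = 0 \<or> t = 1) \<and> odd r \<and> r \<ge> 5) \<or> (r, s, t) \<in> set sporadic"
  using assms unfolding five_chromatic_params_def
proof (elim UnE)
  show ?thesis if "(r, s, t) \<in> {(1, s, t) | s t. (t, s) \<in> {(3,13), (3,17), (3,18), (3,25), (4,17), (6,17),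
      (6,25), (6,33), (7,19), (7,25), (7,26), (9,25), (10,25), (10,26), (10,37), (14,33)}}"
  proof -
    have "(r, s, t) \<in> set sporadic" using that by (auto simp: sporadic_def)
    then show ?thesis by (intro disjI2)
  qed
  show ?thesis if "(r, s, t) \<in> {(2, s, t) | s t. (t, s) \<in> {(3,9), (3,13), (4,9), (8,13)}}"
  proof -
    have "(r, s, t) \<in> set sporadic" using that by (auto simp: sporadic_def)
    then show ?thesis by (intro disjI2)
  qed
  show ?thesis if "(r, s, t) \<in> {(3, s, t) | s t. (t, s) \<in> {(1,6), (2,6), (2,11), (6,11)}}"
  proof -
    have "(r, s, t) \<in> set sporadic" using that by (auto simp: sporadic_def)
    then show ?thesis by (intro disjI2)
  qed
  show ?thesis if "(r, s, t) \<in> {(5, s, t) | s t. (t, s) \<in> {(2,5), (3,5)}}"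
  proof -
    have "(r, s, t) \<in> set sporadic" using that by (auto simp: sporadic_def)
    then show ?thesis by (intro disjI2)
  qed
qed (simp_all, blast?)

lemma sporadic_five: "p \<in> set sporadic \<Longrightarrow> p \<in> five_chromatic_params"
  unfolding sporadic_def list.set
  by (elim insertE emptyE; simp add: five_chromatic_params_def)

lemma no_character5_five:
  assumes "(r, s, t) \<in> set no_character5" "(r, s, t) \<in> five_chromatic_params"
  shows "(r, s, t) = (1, 13, 3)"
  using assms(1) five_cases[OF assms(2)] unfolding no_character5_def list.set
  by (elim insertE emptyE; simp add: sporadic_def)

lemma small_ok_upto_55:
  assumes "r \<ge> 1" "s \<ge> 1" "0 \<le> t" "t \<le> s - 1" "r = 1 \<longrightarrow> 2 * t \<le> s - 1" "r * s \<le> 55"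
  shows "small_ok r s t"
proof -
  have rs: "r \<le> 55" "s \<le> 55"
  proof -
    have "r * 1 \<le> r * s" "1 * s \<le> r * s" using assms(1,2) by (intro mult_left_mono mult_right_mono; simp)+
    then show "r \<le> 55" "s \<le> 55" using assms(6) by linarith+
  qed
  have t: "t \<in> set [0..s - 1]" using assms by simp
  consider "r = 1" | "r = 2" | "r \<ge> 3" using assms(1) by linarith
  then show ?thesis
  proof cases
    case 1
    then have "t \<in> set [0..(s - 1) div 2]" using assms(3,5) by auto
    moreover have "s \<in> set [1..55]" unfolding set_upto using assms(2) rs by simp
    ultimately show ?thesis using small_ok_one_row 1 by blast
  next
    case 2
    then have "s \<in> set [1..27]" unfolding set_upto using assms(2,6) by auto
    then show ?thesis using small_ok_two_rows 2 t by blast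
  next
    case 3
    have "s \<le> 55 div r" using zdiv_mono1[OF assms(6), of r] assms(1) by simp
    then have "s \<in> set [1..55 div r]" unfolding set_upto using assms(2) by simp
    moreover have "r \<in> set [3..55]" unfolding set_upto using 3 rs by simp
    ultimately show ?thesis using small_ok_more_rows t by blast
  qed
qed

text \<open>Both claims share one case split: index at least 56 is the geometric argument, index at
  most 55 the certificates. A short vector refers the first claim to
  \<open>short_colorable4\<close>.\<close>

lemma loopless_colorable:
  assumes rst: "r \<ge> 1" "s \<ge> 1" "0 \<le> t" "t \<le> s - 1" "r = 1 \<longrightarrow> 2 * t \<le> s - 1"
    and nl: "loopless r s t"
  shows "(r, s, t) \<in> {(1, 7, 2)} \<union> K6_params \<union> AH_params \<union> five_chromatic_params \<or> colorable 4 (T r s t)"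
    and "(r, s, t) \<in> five_chromatic_params \<Longrightarrow> colorable 5 (T r s t)"
proof -
  let ?E = "{(1, 7, 2)} \<union> K6_params \<union> AH_params \<union> five_chromatic_params"
  have short: "(r, s, t) \<in> ?E \<or> colorable 4 (T r s t)" if "has_short r s t"
    using short_colorable4[OF rst nl that] by blast
  have "((r, s, t) \<in> ?E \<or> colorable 4 (T r s t)) \<and>
    ((r, s, t) \<in> five_chromatic_params \<longrightarrow> colorable 5 (T r s t))"
  proof (cases "r * s \<ge> 56")
    case True
    have "(\<exists>x y. in_lattice r s t x y \<and> hex_norm (x, y) \<in> {4, 7} \<and> colorable 5 (T r s t)) \<or>
        colorable 4 (T r s t)"
      using colorable_large[OF rst(1,2) True] loopless_hex_norm[OF nl] by blast
    then show ?thesis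
    proof
      assume "\<exists>x y. in_lattice r s t x y \<and> hex_norm (x, y) \<in> {4, 7} \<and> colorable 5 (T r s t)"
      then have "has_short r s t" "colorable 5 (T r s t)" using has_short_of_hex_norm by blast+
      then show ?thesis using short by blast
    next
      assume "colorable 4 (T r s t)"
      then show ?thesis using colorable_mono[of 4 "T r s t" 5] by simp
    qed
  next
    case False
    then have ok: "small_ok r s t" using small_ok_upto_55[OF rst] by simp
    show ?thesis
    proof (cases "has_short r s t \<or> (r, s, t) \<in> set sporadic")
      case True
      then have c5: "has_character 5 r s t \<or> (r, s, t) \<in> set no_character5"
        using ok nl unfolding small_ok_def by simp
      have "colorable 5 (T r s t)" if "(r, s, t) \<in> five_chromatic_params"
        using c5
      proof
        assume "has_character 5 r s t"
        then show ?thesis using colorable_of_character[OF rst(1,2), of 5 t] by simp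
      next
        assume "(r, s, t) \<in> set no_character5"
        then show ?thesis using no_character5_five that colorable5_13 by blast
      qed
      moreover have "(r, s, t) \<in> ?E \<or> colorable 4 (T r s t)"
        using True short sporadic_five by blast
      ultimately show ?thesis by blast
    next
      case False
      then have "has_character 4 r s t \<or> (r, s, t) \<in> set (map fst coloring_table)"
        using ok nl unfolding small_ok_def by simp
      then have "colorable 4 (T r s t)"
      proof
        assume "has_character 4 r s t"
        then show ?thesis using colorable_of_character[OF rst(1,2), of 4 t] by simp
      next
        assume "(r, s, t) \<in> set (map fst coloring_table)"
        then obtain rows where "((r, s, t), rows) \<in> set coloring_table" by auto
        then show ?thesis using coloring_table_proper colorable_of_table by blast
      qed
      then show ?thesis using colorable_mono[of 4 "T r s t" 5] by simp
    qed
  qed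
  then show "(r, s, t) \<in> ?E \<or> colorable 4 (T r s t)"
    "(r, s, t) \<in> five_chromatic_params \<Longrightarrow> colorable 5 (T r s t)" by blast+
qed

lemma in_noncolorable_table:
  assumes "(k, r, s, t) \<in> set (map (\<lambda>e. (fst e, fst (snd e))) noncolorable_table)"
  shows "\<not> colorable k (T r s t)"
  using assms not_colorable_of_table by fastforce

lemma sporadic_noncolorable_table:
  "\<forall>p \<in> set ([(1,5,1), (1,5,2)] @ sporadic).
     (4, p) \<in> set (map (\<lambda>e. (fst e, fst (snd e))) noncolorable_table)"
  "\<forall>p \<in> set [(1,6,2), (2,3,0), (2,3,1), (3,2,0), (3,2,1), (1,11,2), (1,11,3), (1,11,4)].
     (5, p) \<in> set (map (\<lambda>e. (fst e, fst (snd e))) noncolorable_table)"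
  by code_simp+

lemma five_not_colorable4:
  assumes "(r, s, t) \<in> five_chromatic_params" and rs: "r \<ge> 1" "s \<ge> 1"
  shows "\<not> colorable 4 (T r s t)"
proof
  assume col: "colorable 4 (T r s t)"
  \<comment> \<open>The arguments of \<open>cube\<close> are p, g, q with (1, 0) congruent to p g
    and (0, 1) to q g, chosen so that p, q and p - q are 1, 2, 3 up to order and sign. Those of
    \<open>inv\<close> are e, d and R.\<close>
  note cube = colorable4_cube_imp_dvd[OF rs col]
  note inv = colorable4_involution_even[OF rs col]
  have tab: False if "(r, s, t) \<in> set ([(1,5,1), (1,5,2)] @ sporadic)"
    using sporadic_noncolorable_table(1) that in_noncolorable_table col by blast
  from five_cases[OF assms(1)] consider (K5) "r = 1" "s = 5" "t = 1 \<or> t = 2"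
    | (r1) "r = 1" "t = 2 \<or> s = 2 * t + 2 \<or> s = 2 * t + 3 \<or> s = 3 * t + 1 \<or> s = 3 * t + 2" "\<not> 4 dvd s"
    | (r2) "r = 2" "t = 0 \<or> t = 1 \<or> t = s - 3 \<or> t = s - 2" "odd s"
    | (r3) "r = 3" "t = s - 2 \<or> t = s - 1" "\<not> 4 dvd s"
    | (s2) "s = 2" "odd r"
    | (spo) "(r, s, t) \<in> set sporadic"
    by argo
  then show False
  proof cases
    case K5
    then show False using tab by auto
  next
    case r1
    from r1(2) consider "t = 2" | "s = 2 * t + 2" | "s = 2 * t + 3" | "s = 3 * t + 1" | "s = 3 * t + 2" by blast
    then show False
    proof cases
      case 1
      then show False using cube[of "-2" 0 1 1] r1 by (simp add: in_lattice_def)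
    next
      case 2
      \<comment> \<open>Here (1, -1) is the antipode, and (0, 1) reaches it after t + 1 = s / 2
        steps.\<close>
      have "s dvd - 2 - t * 2" using 2 by (metis diff_minus_eq_add dvd_minus_iff dvd_refl minus_diff_eq mult.commute)
      then have "even (t + 1)"
        using inv[of 1 "- 1" 0 1 "t + 1"] r1(1) 2 dvd_minus_iff[of s "2 * t + 2"]
        by (simp add: in_lattice_def algebra_simps)
      then show False using 2 r1(3) by presburger
    next
      case 3
      then show False using cube[of 3 1 "- 1" 2] r1 by (simp add: in_lattice_def algebra_simps)
    next
      case 4
      then show False using cube[of 1 1 0 3] r1 by (simp add: in_lattice_def algebra_simps)
    next
      case 5
      have "- 2 - t * 3 = - s" using 5 by simp
      then have "s dvd - 2 - t * 3" by simp
      then show False using cube[of 2 "- 1" 1 3] r1(1,3) by (simp add: in_lattice_def)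
    qed
  next
    case r2
    from r2(3) have n4: "\<not> 4 dvd 2 * s" by presburger
    from r2(2) show False
    proof (elim disjE)
      assume "t = 0"
      then show False using inv[of 1 0 0 1 s] r2 by (simp add: in_lattice_def)
    next
      assume "t = 1"
      then show False using cube[of 1 1 0 "- 2"] r2 n4 by (simp add: in_lattice_def)
    next
      assume "t = s - 3"
      then show False using cube[of 3 1 "- 1" 2] r2 n4 by (simp add: in_lattice_def)
    next
      assume "t = s - 2"
      then show False using inv[of 1 "- 1" 0 1 s] r2 by (simp add: in_lattice_def)
    qed
  next
    case r3
    from r3(3) have n4: "\<not> 4 dvd 3 * s" by presburger
    from r3(2) show False
    proof
      assume "t = s - 2"
      then show False using cube[of 2 "- 1" 1 3] r3 n4 by (simp add: in_lattice_def)
    next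
      assume "t = s - 1"
      then show False using cube[of 1 1 0 3] r3 n4 by (simp add: in_lattice_def)
    qed
  next
    case s2
    \<comment> \<open>After \<open>r\<close> rows the walk is back at the same edge, with its ends
      exchanged if \<open>t\<close> is odd.\<close>
    have "in_lattice r s t (r * 1 - 0) (r * 0 - 1) \<or> in_lattice r s t (r * 1) (r * 0)"
      using rs s2(1) by (simp add: in_lattice_def)
    then show False using inv[of 0 1 1 0 r] s2 rs by (auto simp: in_lattice_def)
  next
    case spo
    then show False using tab by simp
  qed
qed

section \<open>Three colours\<close>

lemma colorable3_iff:
  assumes rs: "r \<ge> 1" "s \<ge> 1"
  shows "colorable 3 (T r s t) \<longleftrightarrow> s mod 3 = 0 \<and> (r - t) mod 3 = 0"
proof
  assume "colorable 3 (T r s t)"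
  then obtain c where c: "lattice_coloring 3 r s t c" using lattice_coloring_of_colorable[OF rs] by blast
  note C = lattice_coloringD[OF c]
  have third: "a = d" if "a < 3" "b < 3" "e < 3" "d < 3" "a \<noteq> b" "a \<noteq> e" "b \<noteq> e" "d \<noteq> b" "d \<noteq> e" for a b e d :: nat
    using that by linarith
  \<comment> \<open>The two triangles on a common edge have the same third colour. Applied to two
    directions of edges, this makes the colour a function of x - y modulo 3.\<close>
  have diag: "c (x + 1) (y + 1) = c x y" for x y
    by (rule third[OF C(1) C(1) C(1) C(1), of _ _ "x + 1" y x "y + 1"])
      (use C(4)[of x y] C(5)[of x y] C(6)[of x y] C(5)[of "x + 1" y] C(4)[of x "y + 1"] in \<open>auto simp: eq_commute\<close>)
  have skew: "c (x + 2) (y - 1) = c x y" for x y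
    by (rule third[OF C(1) C(1) C(1) C(1), of _ _ "x + 1" y "x + 1" "y - 1"])
      (use C(4)[of x y] C(5)[of "x + 1" "y - 1"] C(6)[of x "y - 1"] C(6)[of "x + 1" "y - 1"] C(4)[of "x + 1" "y - 1"]
        in \<open>auto simp: eq_commute add.commute\<close>)
  have 3: "c x (y + 3) = c x y" for x y
    using skew[of x "y + 3"] diag[of "x + 1" "y + 1"] diag[of x y] by (simp add: algebra_simps)
  have col: "c 0 y = c 0 (y mod 3)" for y
    using int_translation_invariant[of "c 0" 3 "y mod 3" "y div 3"] 3 by simp
  have ne: "c 0 1 \<noteq> c 0 0" "c 0 2 \<noteq> c 0 0"
    using C(5)[of 0 0] C(6)[of "- 1" 0] diag[of "- 1" 1] by simp_all
  have zero: "y mod 3 = 0" if "c 0 y = c 0 0" for y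
  proof -
    have "0 \<le> y mod 3" "y mod 3 < 3" by simp_all
    then have "y mod 3 = 0 \<or> y mod 3 = 1 \<or> y mod 3 = 2" by linarith
    then show ?thesis using that col[of y] ne by auto
  qed
  have "c 0 (t - r) = c 0 0"
  proof -
    have "c (0 + r) (t - r + r) = c 0 (t - r)"
      using int_translation_invariant[of "\<lambda>a. c a (t - r + a)" 1 0 r] diag[of _ "t - r + _"]
      by (simp add: add.assoc)
    then show ?thesis using C(3)[of 0 0] by simp
  qed
  then have "(t - r) mod 3 = 0" by (rule zero)
  moreover have "s mod 3 = 0" using zero[of s] C(2)[of 0 0] by simp
  ultimately show "s mod 3 = 0 \<and> (r - t) mod 3 = 0" by presburger
next
  assume "s mod 3 = 0 \<and> (r - t) mod 3 = 0"
  then have "3 dvd s * - 1" "3 dvd r * 1 + t * - 1" by auto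
  then show "colorable 3 (T r s t)"
    using colorable_of_lattice_coloring[OF rs lattice_coloring_character[of 3 3 s "- 1" r 1 t]]
    by (simp add: spread_def)
qed

lemma not_colorable2:
  assumes rs: "r \<ge> 1" "s \<ge> 1"
  shows "\<not> colorable 2 (T r s t)"
proof
  assume "colorable 2 (T r s t)"
  then obtain c where "lattice_coloring 2 r s t c" using lattice_coloring_of_colorable[OF rs] by blast
  note C = lattice_coloringD[OF this, of 0 0]
  show False using C(1,4-6) lattice_coloringD(1)[OF \<open>lattice_coloring 2 r s t c\<close>, of 1 0]
    lattice_coloringD(1)[OF \<open>lattice_coloring 2 r s t c\<close>, of 0 1] by simp
qed

section \<open>Isomorphisms\<close>

lemma wrap_add_period: "wrap n (x + n) = wrap n x"
  using mod_add_self2[of "x - 1" n] by (simp add: wrap_def algebra_simps)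

text \<open>One permutation of the six neighbour positions serves all vertices, so the map on arcs
  is a product.\<close>

lemma T_digraph_isoI:
  assumes rs: "r \<ge> 1" "s \<ge> 1" and bij: "bij_betw \<phi> ({1..r} \<times> {1..s}) ({1..r'} \<times> {1..s'})"
    and perm: "bij_betw \<pi> {..<6} {..<6}"
    and nbrs: "\<And>v k. v \<in> {1..r} \<times> {1..s} \<Longrightarrow> k < 6 \<Longrightarrow>
      T_nbrs r' s' t' (\<phi> v) ! \<pi> k = \<phi> (T_nbrs r s t v ! k)"
  shows "digraph_iso (T r s t) (T r' s' t')"
proof -
  interpret pseudo_graph "T r s t" using T_pseudo_graph[OF rs] .
  define h where "h = \<lparr>iso_verts = \<phi>, iso_arcs = map_prod \<phi> \<pi>, iso_head = head (T r' s' t'),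
    iso_tail = tail (T r' s' t')\<rparr>"
  have \<phi>: "inj_on \<phi> ({1..r} \<times> {1..s})" "\<phi> ` ({1..r} \<times> {1..s}) = {1..r'} \<times> {1..s'}"
    using bij unfolding bij_betw_def by blast+
  have \<pi>: "inj_on \<pi> {..<6}" "\<pi> ` {..<6} = {..<6}"
    using perm unfolding bij_betw_def by blast+
  have G: "verts (T r s t) = {1..r} \<times> {1..s}" "arcs (T r s t) = ({1..r} \<times> {1..s}) \<times> {..<6}"
    "\<And>v k. tail (T r s t) (v, k) = v" "\<And>v k. head (T r s t) (v, k) = T_nbrs r s t v ! k" for r s t
    by (simp_all add: T_def)
  have "digraph_isomorphism h"
    unfolding digraph_isomorphism_def
  proof (intro conjI ballI)
    show "wf_digraph (T r s t)" by (rule wf_digraph_axioms)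
    show "inj_on (iso_verts h) (verts (T r s t))" unfolding G h_def using \<phi>(1) by simp
    show "inj_on (iso_arcs h) (arcs (T r s t))"
      unfolding G h_def using map_prod_inj_on[OF \<phi>(1) \<pi>(1)] by simp
    fix a assume "a \<in> arcs (T r s t)"
    then obtain v k where a: "a = (v, k)" "v \<in> {1..r} \<times> {1..s}" "k < 6"
      unfolding G by (metis SigmaE lessThan_iff)
    show "iso_verts h (tail (T r s t) a) = iso_tail h (iso_arcs h a)" by (simp add: a(1) h_def G(3))
    show "iso_verts h (head (T r s t) a) = iso_head h (iso_arcs h a)"
      using nbrs[OF a(2,3)] by (simp add: a(1) h_def G(4))
  qed
  moreover have "T r' s' t' = app_iso h (T r s t)"
  proof (rule pre_digraph.equality)
    show "verts (T r' s' t') = verts (app_iso h (T r s t))" by (simp add: G(1) h_def \<phi>(2))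
    show "arcs (T r' s' t') = arcs (app_iso h (T r s t))"
      using map_prod_surj_on[OF \<phi>(2) \<pi>(2)] by (simp add: G(2) h_def)
  qed (simp_all add: h_def)
  ultimately show ?thesis unfolding digraph_iso_def by blast
qed

lemma less_6_cases: "k < 6 \<Longrightarrow> k = 0 \<or> k = 1 \<or> k = 2 \<or> k = 3 \<or> k = 4 \<or> k = (5::nat)"
  by presburger

lemma bij_betw_nth_lessThan:
  assumes "length xs = n" "distinct xs" "\<forall>i \<in> set xs. i < n"
  shows "bij_betw ((!) xs) {..<n} {..<n}"
proof -
  have "card (set xs) = n" using distinct_card[OF assms(2)] assms(1) by simp
  moreover have "set xs \<subseteq> {..<n}" using assms(3) by (simp add: subset_iff)
  ultimately have "set xs = {..<n}" by (intro card_subset_eq) simp_all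
  then show ?thesis by (intro bij_betw_nth[OF assms(2)]) (simp_all add: assms(1))
qed

text \<open>Replacing t by s - t - 1 exchanges the differences t and t + 1 up to sign modulo s;
  vertices stay fixed and only neighbour positions are permuted.\<close>

lemma T1_iso_reflect:
  assumes "s \<ge> 1"
  shows "digraph_iso (T 1 s t) (T 1 s (s - t - 1))"
proof (rule T_digraph_isoI[where \<phi> = id and \<pi> = "(!) [0, 1, 5, 4, 3, 2]"])
  show "bij_betw ((!) [0, 1, 5, 4, 3, 2]) {..<6} {..<6 :: nat}"
    by (rule bij_betw_nth_lessThan) simp_all
  fix v :: "int \<times> int" and k :: nat assume v: "v \<in> {1..1} \<times> {1..s}" and k: "k < 6"
  obtain j where j: "v = (1, j)" using v by (cases v) auto
  have w: "wrap s (j + (s - t - 1)) = wrap s (j - (t + 1))" "wrap s (j - (s - t - 1)) = wrap s (j + (t + 1))"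
    "wrap s (j + (s - t - 1 + 1)) = wrap s (j - t)" "wrap s (j - (s - t - 1 + 1)) = wrap s (j + t)"
  proof -
    have "j + (s - t - 1) = j - (t + 1) + s" "j + (t + 1) = j - (s - t - 1) + s"
      "j + (s - t - 1 + 1) = j - t + s" "j + t = j - (s - t - 1 + 1) + s" by simp_all
    then show "wrap s (j + (s - t - 1)) = wrap s (j - (t + 1))" "wrap s (j - (s - t - 1)) = wrap s (j + (t + 1))"
      "wrap s (j + (s - t - 1 + 1)) = wrap s (j - t)" "wrap s (j - (s - t - 1 + 1)) = wrap s (j + t)"
      by (simp_all only: wrap_add_period)
  qed
  show "T_nbrs 1 s (s - t - 1) (id v) ! ([0, 1, 5, 4, 3, 2] ! k) = id (T_nbrs 1 s t v ! k)"
    unfolding j id_apply T_nbrs_simps(1) w using less_6_cases[OF k] by (elim disjE) simp_all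
qed (use assms in simp_all)

lemma digraph_iso_colorable:
  assumes "digraph_iso G H"
  shows "colorable k G \<longleftrightarrow> colorable k H" "card (verts G) = card (verts H)"
proof -
  obtain f where "pre_digraph.digraph_isomorphism G f" and H: "H = app_iso f G"
    using assms unfolding digraph_iso_def by blast
  then have wf: "wf_digraph G" and inj: "inj_on (iso_verts f) (verts G)"
    and ends: "\<And>a. a \<in> arcs G \<Longrightarrow> iso_verts f (tail G a) = iso_tail f (iso_arcs f a)"
      "\<And>a. a \<in> arcs G \<Longrightarrow> iso_verts f (head G a) = iso_head f (iso_arcs f a)"
    unfolding pre_digraph.digraph_isomorphism_def by blast+
  show "card (verts G) = card (verts H)" using inj by (simp add: H card_image)
  show "colorable k G \<longleftrightarrow> colorable k H"
  proof
    assume "colorable k G"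
    then obtain c where c: "\<forall>v \<in> verts G. c v < k" "\<forall>e \<in> arcs G. c (tail G e) \<noteq> c (head G e)"
      unfolding colorable_def by blast
    let ?g = "the_inv_into (verts G) (iso_verts f)"
    have g: "?g (iso_verts f v) = v" if "v \<in> verts G" for v using the_inv_into_f_f[OF inj that] .
    show "colorable k H" unfolding colorable_def
    proof (intro exI[of _ "c \<circ> ?g"] conjI ballI)
      show "(c \<circ> ?g) v < k" if "v \<in> verts H" for v using that c(1) g by (auto simp: H)
      fix e assume "e \<in> arcs H"
      then obtain a where a: "a \<in> arcs G" "e = iso_arcs f a" by (auto simp: H)
      then show "(c \<circ> ?g) (tail H e) \<noteq> (c \<circ> ?g) (head H e)"
        using c(2) g wf_digraph.tail_in_verts[OF wf a(1)] wf_digraph.head_in_verts[OF wf a(1)]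
        by (simp add: H ends[OF a(1), symmetric])
    qed
  next
    assume "colorable k H"
    then obtain c where c: "\<forall>v \<in> verts H. c v < k" "\<forall>e \<in> arcs H. c (tail H e) \<noteq> c (head H e)"
      unfolding colorable_def by blast
    show "colorable k G" unfolding colorable_def
    proof (intro exI[of _ "c \<circ> iso_verts f"] conjI ballI)
      show "(c \<circ> iso_verts f) v < k" if "v \<in> verts G" for v using that c(1) by (simp add: H)
      show "(c \<circ> iso_verts f) (tail G e) \<noteq> (c \<circ> iso_verts f) (head G e)" if "e \<in> arcs G" for e
        using c(2) that ends[OF that] by (simp add: H)
    qed
  qed
qed

section \<open>Complete graphs and the Albertson-Hutchinson graph\<close>

lemma complete_digraph_chromatic:
  assumes "complete_digraph k G" "k > 0"
  shows "chromatic k G"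
proof -
  interpret graph G using assms(1) by (simp add: complete_digraph_def)
  have card: "card (verts G) = k" and ends: "arcs_ends G = {(u, v). (u, v) \<in> verts G \<times> verts G \<and> u \<noteq> v}"
    using assms(1) by (simp_all add: complete_digraph_def)
  have "colorable k G"
  proof -
    obtain f where f: "bij_betw f (verts G) {0..<k}"
      using ex_bij_betw_finite_nat[OF finite_verts] card by auto
    show ?thesis unfolding colorable_def
    proof (intro exI[of _ f] conjI ballI)
      show "f v < k" if "v \<in> verts G" for v using bij_betwE[OF f] that by auto
      show "f (tail G e) \<noteq> f (head G e)" if "e \<in> arcs G" for e
        using no_loops[OF that] bij_betw_imp_inj_on[OF f] that by (auto dest!: inj_onD)
    qed
  qed
  moreover have "\<not> colorable (k - 1) G"
  proof
    assume "colorable (k - 1) G"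
    then obtain c where c: "\<forall>v \<in> verts G. c v < k - 1" "\<forall>e \<in> arcs G. c (tail G e) \<noteq> c (head G e)"
      unfolding colorable_def by blast
    have "inj_on c (verts G)"
    proof (rule inj_onI, rule ccontr)
      fix u v assume uv: "u \<in> verts G" "v \<in> verts G" "c u = c v" "u \<noteq> v"
      then have "(u, v) \<in> arcs_ends G" unfolding ends by simp
      then show False using c(2) uv(3) by (auto simp: arcs_ends_conv)
    qed
    then have "card (verts G) \<le> card {..<k - 1}" using c(1) by (intro card_inj_on_le) auto
    then show False using card assms(2) by simp
  qed
  ultimately show ?thesis using chromatic_iff[OF assms(2)] by blast
qed

lemma colorable_dedup: "colorable k (dedup G) \<longleftrightarrow> colorable k G"
  unfolding colorable_def dedup_def mk_symmetric_def by (auto simp: eq_commute)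

lemma chromatic_dedup: "chromatic k (dedup G) \<longleftrightarrow> chromatic k G"
  unfolding chromatic_def colorable_dedup ..

definition all_adjacent :: "int \<Rightarrow> int \<times> int \<times> int \<Rightarrow> bool" where
  "all_adjacent n = (\<lambda>(r, s, t). r \<ge> 1 \<and> s \<ge> 1 \<and> r * s = n \<and>
     (\<forall>v \<in> set (List.product [1..r] [1..s]). \<forall>u \<in> set (List.product [1..r] [1..s]).
        u \<in> set (T_nbrs r s t v) \<longleftrightarrow> u \<noteq> v))"

lemma all_adjacentD:
  assumes "all_adjacent (int n) (r, s, t)"
  shows "r \<ge> 1" "s \<ge> 1" "card ({1..r} \<times> {1..s}) = n"
    "arcs_ends (T r s t) = {(v, u). (v, u) \<in> ({1..r} \<times> {1..s}) \<times> ({1..r} \<times> {1..s}) \<and> v \<noteq> u}"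
proof -
  show rs: "r \<ge> 1" "s \<ge> 1" using assms by (simp_all add: all_adjacent_def)
  have "r * s = int n" using assms by (simp add: all_adjacent_def)
  then show "card ({1..r} \<times> {1..s}) = n"
    using rs by (simp add: card_cartesian_product flip: nat_mult_distrib)
  have "\<forall>v \<in> {1..r} \<times> {1..s}. \<forall>u \<in> {1..r} \<times> {1..s}. u \<in> set (T_nbrs r s t v) \<longleftrightarrow> u \<noteq> v"
    using assms unfolding all_adjacent_def case_prod_conv set_product set_upto by blast
  then show "arcs_ends (T r s t) =
      {(v, u). (v, u) \<in> ({1..r} \<times> {1..s}) \<times> ({1..r} \<times> {1..s}) \<and> v \<noteq> u}"
    unfolding T_arcs_ends using T_nbrs_in_verts[OF rs] by blast
qed

lemma dedup_T_complete:
  assumes "all_adjacent (int n) (r, s, t)"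
  shows "complete_digraph n (dedup (T r s t))"
  unfolding dedup_def complete_digraph_pair_def
proof (intro conjI)
  note A = all_adjacentD[OF assms]
  have V: "pverts (mk_symmetric (T r s t)) = {1..r} \<times> {1..s}" by (simp add: mk_symmetric_def T_def)
  show "finite (pverts (mk_symmetric (T r s t)))" unfolding V by simp
  show "card (pverts (mk_symmetric (T r s t))) = n" unfolding V by (rule A(3))
  have *: "parcs (mk_symmetric G) = arcs_ends G \<union> (arcs_ends G)\<inverse>"
    for G :: "(int \<times> int, (int \<times> int) \<times> nat) pre_digraph"
    unfolding mk_symmetric_def by (auto simp: arcs_ends_conv)
  show "parcs (mk_symmetric (T r s t)) = {(u, v). (u, v) \<in>
      (pverts (mk_symmetric (T r s t)) \<times> pverts (mk_symmetric (T r s t))) \<and> u \<noteq> v}"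
    unfolding V * A(4) by auto
qed

lemma T_complete:
  assumes "all_adjacent (int n) (r, s, t)"
    and dist: "\<And>v. v \<in> {1..r} \<times> {1..s} \<Longrightarrow> distinct (T_nbrs r s t v)"
  shows "complete_digraph n (T r s t)"
proof -
  note A = all_adjacentD[OF assms(1)]
  interpret pseudo_graph "T r s t" using T_pseudo_graph[OF A(1,2)] .
  have V: "verts (T r s t) = {1..r} \<times> {1..s}" by (simp add: T_def)
  have "graph (T r s t)"
  proof
    fix e assume "e \<in> arcs (T r s t)"
    then have "(tail (T r s t) e, head (T r s t) e) \<in> arcs_ends (T r s t)" by (auto simp: arcs_ends_conv)
    then show "tail (T r s t) e \<noteq> head (T r s t) e" unfolding A(4) by simp
  next
    fix e1 e2 assume e: "e1 \<in> arcs (T r s t)" "e2 \<in> arcs (T r s t)"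
      and "arc_to_ends (T r s t) e1 = arc_to_ends (T r s t) e2"
    then have "fst e1 = fst e2" "T_nbrs r s t (fst e1) ! snd e1 = T_nbrs r s t (fst e2) ! snd e2"
      by (auto simp: T_def arc_to_ends_def split: prod.splits)
    moreover have "fst e1 \<in> {1..r} \<times> {1..s}" "snd e1 < 6" "snd e2 < 6" using e by (auto simp: T_def)
    ultimately have "snd e1 = snd e2"
      using nth_eq_iff_index_eq[OF dist, of "fst e1" "snd e1" "snd e2"] by (simp add: length_T_nbrs)
    then show "e1 = e2" using \<open>fst e1 = fst e2\<close> by (simp add: prod_eq_iff)
  qed
  then show ?thesis unfolding complete_digraph_def V using A(3,4) by simp
qed

lemma T_1_7_2_complete: "complete_digraph 7 (T 1 7 2)"
proof (rule T_complete)
  show "all_adjacent (int 7) (1, 7, 2)" by code_simp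
  have "\<forall>v \<in> set (List.product [1..1] [1..7]). distinct (T_nbrs 1 7 2 v)" by code_simp
  then show "distinct (T_nbrs 1 7 2 v)" if "v \<in> {1..1} \<times> {1..7}" for v
    using that unfolding set_product set_upto by blast
qed

lemma K6_complete:
  assumes "p \<in> K6_params"
  shows "complete_digraph 6 (dedup (case p of (r, s, t) \<Rightarrow> T r s t))"
proof -
  have "\<forall>p \<in> set [(1,6,2), (2,3,0), (2,3,1), (3,2,0), (3,2,1)]. all_adjacent (int 6) p" by code_simp
  then have "all_adjacent (int 6) p" using assms unfolding K6_params_def list.set by blast
  then show ?thesis using dedup_T_complete[of 6 "fst p" "fst (snd p)" "snd (snd p)"] by (simp add: case_prod_beta)
qed

lemma K5_complete:
  assumes "p \<in> {(1, 5, 1), (1, 5, 2)}"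
  shows "complete_digraph 5 (dedup (case p of (r, s, t) \<Rightarrow> T r s t))"
proof -
  have "\<forall>p \<in> set [(1,5,1), (1,5,2)]. all_adjacent (int 5) p" by code_simp
  then have "all_adjacent (int 5) p" using assms unfolding list.set by blast
  then show ?thesis using dedup_T_complete[of 5 "fst p" "fst (snd p)" "snd (snd p)"] by (simp add: case_prod_beta)
qed

text \<open>The graphs are circulant modulo 11 with differences 1, t and t + 1. Multiplication by 3
  carries {1, 3, 4}, and multiplication by 9 carries {1, 4, 5}, to {1, 2, 3} up to sign; the list
  \<open>p\<close> records the effect on neighbour positions.\<close>

lemma AH_iso:
  assumes "(r, s, t) \<in> AH_params"
  shows "digraph_iso (T r s t) Albertson_Hutchinson"
proof -
  have iso: "digraph_iso (T 1 11 t) (T 1 11 2)"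
    if chk: "distinct (map (\<lambda>j. wrap 11 (m * j)) [1..11])"
      "length p = 6 \<and> distinct p \<and> (\<forall>i \<in> set p. i < 6)"
      "\<forall>j \<in> set [1..11]. map (\<lambda>k. T_nbrs 1 11 2 (1, wrap 11 (m * j)) ! k) p =
         map (map_prod id (\<lambda>j. wrap 11 (m * j))) (T_nbrs 1 11 t (1, j))"
    for m t p
  proof (rule T_digraph_isoI[where \<phi> = "map_prod id (\<lambda>j. wrap 11 (m * j))" and \<pi> = "(!) p"])
    show "bij_betw ((!) p) {..<6} {..<6}" using bij_betw_nth_lessThan chk(2) by blast
    let ?w = "\<lambda>j. wrap 11 (m * j)"
    have "inj_on ?w {1..11}" using chk(1) by (simp only: distinct_map set_upto)
    moreover have "?w ` {1..11} \<subseteq> {1..11}" by (intro image_subsetI wrap_in) simp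
    ultimately have "bij_betw ?w {1..11} {1..11}"
      using endo_inj_surj[of "{1..11}" ?w] by (simp only: bij_betw_def finite_atLeastAtMost_int simp_thms)
    then show "bij_betw (map_prod id ?w) ({1..1} \<times> {1..11}) ({1..1} \<times> {1..11})"
      by (intro bij_betw_map_prod) simp_all
    fix v :: "int \<times> int" and k :: nat assume v: "v \<in> {1..1} \<times> {1..11}" and k: "k < 6"
    have len: "length p = 6" using chk(2) by blast
    obtain j where "v = (1, j)" "j \<in> {1..11}" using v by (cases v) auto
    then have j: "v = (1, j)" "j \<in> set [1..11]" unfolding set_upto by blast+
    show "T_nbrs 1 11 2 (map_prod id ?w v) ! (p ! k) = map_prod id ?w (T_nbrs 1 11 t v ! k)"
      using arg_cong[OF chk(3)[rule_format, OF j(2)], of "\<lambda>l. l ! k"] k len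
      by (simp add: j(1) length_T_nbrs)
  qed simp_all
  have "digraph_iso (T 1 11 2) (T 1 11 2)"
    by (rule iso[of 1 "[0, 1, 2, 3, 4, 5]"]) (code_simp+)
  moreover have "digraph_iso (T 1 11 3) (T 1 11 2)"
    by (rule iso[of 3 "[4, 5, 3, 2, 0, 1]"]) (code_simp+)
  moreover have "digraph_iso (T 1 11 4) (T 1 11 2)"
    by (rule iso[of 9 "[3, 2, 4, 5, 0, 1]"]) (code_simp+)
  ultimately show ?thesis using assms unfolding AH_params_def Albertson_Hutchinson_def by blast
qed

lemma AH_colorable6: "colorable 6 Albertson_Hutchinson"
proof -
  have "has_character 6 1 11 2" by code_simp
  then show ?thesis using colorable_of_character[of 1 11 6 2] by (simp add: Albertson_Hutchinson_def)
qed

lemma five_chromatic_loopless: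
  assumes "(r, s, t) \<in> five_chromatic_params" "r \<ge> 1" "s \<ge> 1" "0 \<le> t" "t \<le> s - 1" "r = 1 \<longrightarrow> 2 * t \<le> s - 1"
  shows "loopless r s t"
proof -
  have "s \<noteq> 1 \<and> \<not> (r = 1 \<and> s = 2) \<and> \<not> (r = 1 \<and> t = 0)"
    using five_cases[OF assms(1)] assms(4) by (elim disjE conjE) (simp_all, auto simp: sporadic_def)
  then show ?thesis using loopless_cases[OF assms(2-6)] by blast
qed

theorem theorem4p2:
  fixes r s t :: int
  assumes "r \<ge> 1" and "s \<ge> 1" and "0 \<le> t" and "t \<le> s - 1"
  shows "(r = 1 \<longrightarrow> digraph_iso (T 1 s t) (T 1 s (s - t - 1))) \<and>
    ((r = 1 \<longrightarrow> t \<le> \<lfloor>real_of_int (s - 1) / 2\<rfloor>) \<longrightarrow>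
      \<comment> \<open>(a)\<close>
      (has_loop (T r s t) \<longleftrightarrow> s = 1 \<or> (r = 1 \<and> s = 2) \<or> (r = 1 \<and> t = 0)) \<and>
      \<comment> \<open>(b)\<close>
      (chromatic 7 (T r s t) \<longleftrightarrow> complete_digraph 7 (T r s t)) \<and>
      (chromatic 7 (T r s t) \<longleftrightarrow> (r, s, t) = (1, 7, 2)) \<and>
      \<comment> \<open>(c)\<close>
      (chromatic 6 (T r s t) \<longleftrightarrow>
         complete_digraph 6 (dedup (T r s t)) \<or> digraph_iso (T r s t) Albertson_Hutchinson) \<and>
      (complete_digraph 6 (dedup (T r s t)) \<longleftrightarrow> (r, s, t) \<in> K6_params) \<and>
      (digraph_iso (T r s t) Albertson_Hutchinson \<longleftrightarrow> (r, s, t) \<in> AH_params) \<and>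
      \<comment> \<open>(d)\<close>
      (chromatic 5 (T r s t) \<longleftrightarrow> (r, s, t) \<in> five_chromatic_params) \<and>
      ((r, s, t) \<in> {(1, 5, 1), (1, 5, 2)} \<longrightarrow> complete_digraph 5 (dedup (T r s t))) \<and>
      \<comment> \<open>(e)\<close>
      (\<not> has_loop (T r s t) \<and>
         (r, s, t) \<notin> {(1, 7, 2)} \<union> K6_params \<union> AH_params \<union> five_chromatic_params \<longrightarrow>
       colorable 4 (T r s t)) \<and>
      \<comment> \<open>(f)\<close>
      (chromatic 3 (T r s t) \<longleftrightarrow> s mod 3 = 0 \<and> (r - t) mod 3 = 0))"
proof (intro conjI impI)
  show "digraph_iso (T 1 s t) (T 1 s (s - t - 1))" if "r = 1" using T1_iso_reflect[OF assms(2)] .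
next
  assume range: "r = 1 \<longrightarrow> t \<le> \<lfloor>real_of_int (s - 1) / 2\<rfloor>"
  have rng: "r = 1 \<longrightarrow> 2 * t \<le> s - 1"
  proof
    assume "r = 1"
    then have "real_of_int t \<le> real_of_int (s - 1) / 2" using range by (simp add: le_floor_iff)
    then have "real_of_int (2 * t) \<le> real_of_int (s - 1)" by simp
    then show "2 * t \<le> s - 1" by (simp only: of_int_le_iff)
  qed
  note rst = assms rng
  let ?G = "T r s t" and ?E7 = "{(1 :: int, 7 :: int, 2 :: int)}"
  have not_col: "\<not> colorable k ?G" if "(k, r, s, t) \<in> set (map (\<lambda>e. (fst e, fst (snd e))) noncolorable_table)" for k
    using in_noncolorable_table that by blast
  have ch: "chromatic k ?G \<longleftrightarrow> colorable k ?G \<and> \<not> colorable (k - 1) ?G" if "k > 0" for k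
    using chromatic_iff[OF that] .
  have mono: "colorable l ?G" if "colorable k ?G" "k \<le> l" for k l using colorable_mono that by blast
  have c7: "chromatic 7 ?G" if "(r, s, t) \<in> ?E7"
    using complete_digraph_chromatic[OF T_1_7_2_complete] that by simp
  have cK6: "complete_digraph 6 (dedup ?G)" if "(r, s, t) \<in> K6_params"
    using K6_complete[OF that] by simp
  have cAH: "digraph_iso ?G Albertson_Hutchinson" if "(r, s, t) \<in> AH_params" using AH_iso that by blast
  have AH5: "\<not> colorable 5 Albertson_Hutchinson"
    unfolding Albertson_Hutchinson_def using sporadic_noncolorable_table(2) in_noncolorable_table by fastforce
  \<comment> \<open>The number of vertices is recorded to tell this graph from K6, which has the
    same chromatic number.\<close>
  have isoAH: "chromatic 6 ?G \<and> r * s = 11" if "digraph_iso ?G Albertson_Hutchinson"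
  proof
    show "chromatic 6 ?G"
      using digraph_iso_colorable(1)[OF that] AH5 AH_colorable6 ch[of 6] by simp
    have "card (verts ?G) = 11" using digraph_iso_colorable(2)[OF that] Albertson_Hutchinson_graph(2) by simp
    then show "r * s = 11"
      using assms(1,2) by (simp add: T_def card_cartesian_product flip: nat_mult_distrib)
  qed
  have ded6: "chromatic 6 ?G \<and> r * s = 6" if "complete_digraph 6 (dedup ?G)"
  proof
    show "chromatic 6 ?G" using complete_digraph_chromatic[OF that] by (simp add: chromatic_dedup)
    have "card (verts (dedup ?G)) = 6" using that by (simp add: complete_digraph_def)
    then have "card (verts ?G) = 6" by (simp add: dedup_def mk_symmetric_def)
    then show "r * s = 6"
      using assms(1,2) by (simp add: T_def card_cartesian_product flip: nat_mult_distrib)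
  qed
  have c6: "chromatic 6 ?G" if "(r, s, t) \<in> K6_params \<union> AH_params" using that cK6 cAH isoAH ded6 by blast
  have c5: "colorable 5 ?G \<and> \<not> colorable 4 ?G" if "(r, s, t) \<in> five_chromatic_params"
    using loopless_colorable(2)[OF rst five_chromatic_loopless[OF that rst] that]
      five_not_colorable4[OF that assms(1,2)] by blast
  have loops: "has_loop ?G" if "\<not> loopless r s t"
  proof -
    have "s = 1 \<or> (r = 1 \<and> s = 2) \<or> (r = 1 \<and> t = 0)" using that loopless_cases[OF rst] by blast
    \<comment> \<open>For r = 1 and s = 2 the range of \<open>t\<close> leaves only t = 0.\<close>
    then have "s = 1 \<or> r = 1 \<and> t = 0" using rng assms(3) by auto
    then have "(1, 1) \<in> set (T_nbrs r s t (1, 1))"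
    proof
      assume s1: "s = 1"
      consider "r = 1" | "r > 1" using assms(1) by linarith
      then show ?thesis by cases (simp_all add: s1 T_nbrs_simps(1,2) wrap_def)
    next
      assume "r = 1 \<and> t = 0"
      then show ?thesis using assms(2) by (simp add: T_nbrs_simps(1) wrap_def)
    qed
    then show ?thesis using T_has_loop[of "(1, 1)" r s t] assms(1,2) by simp
  qed
  have loop_col: "loopless r s t" if "colorable k ?G" for k
    using that loops colorable_no_loop by blast
  have c4: "colorable 4 ?G" if "loopless r s t" "(r, s, t) \<notin> ?E7 \<union> K6_params \<union> AH_params \<union> five_chromatic_params"
    using loopless_colorable(1)[OF rst that(1)] that(2) by blast
  have all7: "colorable 7 ?G" if "loopless r s t"
  proof -
    have "colorable 7 ?G" if "(r, s, t) \<in> ?E7" using c7[OF that] ch[of 7] by simp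
    moreover have "colorable 6 ?G" if "(r, s, t) \<in> K6_params \<union> AH_params" using c6[OF that] ch[of 6] by simp
    ultimately show ?thesis using c5 c4[OF that] mono[of 4 7] mono[of 5 7] mono[of 6 7] by auto
  qed
  \<comment> \<open>Absence of loops is deduced from 7-colourability, not from the neighbour
    lists.\<close>
  have has_loop_iff: "has_loop ?G \<longleftrightarrow> \<not> loopless r s t" using loops all7 colorable_no_loop by blast
  show a: "has_loop ?G \<longleftrightarrow> s = 1 \<or> (r = 1 \<and> s = 2) \<or> (r = 1 \<and> t = 0)"
    unfolding has_loop_iff using loopless_cases[OF rst] by blast
  have below7: "colorable 6 ?G" if "loopless r s t" "(r, s, t) \<notin> ?E7"
  proof -
    have "colorable 6 ?G" if "(r, s, t) \<in> K6_params \<union> AH_params" using c6[OF that] ch[of 6] by simp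
    then show ?thesis using c5 c4[OF that(1)] that(2) mono[of 4 6] mono[of 5 6] by auto
  qed
  have below6: "colorable 5 ?G" if "loopless r s t" "(r, s, t) \<notin> ?E7 \<union> K6_params \<union> AH_params"
    using c5 c4 that mono[of 4 5] by auto
  show b: "chromatic 7 ?G \<longleftrightarrow> (r, s, t) = (1, 7, 2)"
    using c7 ch[of 7] loop_col below7 by auto
  show "chromatic 7 ?G \<longleftrightarrow> complete_digraph 7 ?G"
    using b T_1_7_2_complete complete_digraph_chromatic[of 7 ?G] by auto
  have c: "chromatic 6 ?G \<longleftrightarrow> (r, s, t) \<in> K6_params \<union> AH_params"
  proof
    assume 6: "chromatic 6 ?G"
    then have col: "colorable 6 ?G" "\<not> colorable 5 ?G" using ch[of 6] by simp_all
    have "\<not> colorable 6 ?G" if "(r, s, t) \<in> ?E7" using c7[OF that] ch[of 7] by simp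
    then show "(r, s, t) \<in> K6_params \<union> AH_params" using col below6[OF loop_col[OF col(1)]] by blast
  qed (rule c6)
  show "complete_digraph 6 (dedup ?G) \<longleftrightarrow> (r, s, t) \<in> K6_params"
    using cK6 ded6 c by (auto simp: AH_params_def)
  show "digraph_iso ?G Albertson_Hutchinson \<longleftrightarrow> (r, s, t) \<in> AH_params"
    using cAH isoAH c by (auto simp: K6_params_def)
  show "chromatic 6 ?G \<longleftrightarrow> complete_digraph 6 (dedup ?G) \<or> digraph_iso ?G Albertson_Hutchinson"
    using c cK6 cAH ded6 isoAH by blast
  show "chromatic 5 ?G \<longleftrightarrow> (r, s, t) \<in> five_chromatic_params"
  proof
    assume 5: "chromatic 5 ?G"
    then have col: "colorable 5 ?G" "\<not> colorable 4 ?G" using ch[of 5] by simp_all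
    have "\<not> colorable 5 ?G" if "(r, s, t) \<in> K6_params \<union> AH_params" using c6[OF that] ch[of 6] by simp
    moreover have "\<not> colorable 5 ?G" if "(r, s, t) \<in> ?E7" using c7[OF that] ch[of 7] mono[of 5 6] by auto
    ultimately show "(r, s, t) \<in> five_chromatic_params" using col c4[OF loop_col[OF col(1)]] by blast
  next
    assume "(r, s, t) \<in> five_chromatic_params"
    then show "chromatic 5 ?G" using c5 ch[of 5] by simp
  qed
  show "complete_digraph 5 (dedup ?G)" if "(r, s, t) \<in> {(1, 5, 1), (1, 5, 2)}"
    using K5_complete[OF that] by simp
  show "colorable 4 ?G"
    if "\<not> has_loop ?G \<and> (r, s, t) \<notin> ?E7 \<union> K6_params \<union> AH_params \<union> five_chromatic_params"
    using that c4 has_loop_iff by blast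
  show "chromatic 3 ?G \<longleftrightarrow> s mod 3 = 0 \<and> (r - t) mod 3 = 0"
    using ch[of 3] colorable3_iff[OF assms(1,2)] not_colorable2[OF assms(1,2)] by simp
qed

end
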